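(* Assume the model is symmetric, i.e. $\lambda_i=\lambda$ and $|V_i|=V$ for all $i=1,\dots,K$. Let $z$ be a fluid limit. If $z_i(t)>0$ for all $i=1,\dots,K$, then (almost surely, with the derivative being the right derivative when $t=0$) $$\Bigl(\sum_i z_i^2(t)\Bigr)'\le 2\Bigl(\lambda-\frac{e^{-1}}{V}\Bigr)\sum_i z_i(t),$$ and hence, if $\lambda<\frac{e^{-1}}{V}$, $$\Bigl(\sum_i z_i^2(t)\Bigr)'\le-\varepsilon\sum_i z_i(t)$$ for some $\varepsilon>0$ (not depending on $z$ and $t$).
   Context: Model. $\mathcal G=(\mathcal V,\mathcal E)$ is a connected undirected graph with finite vertex set $\mathcal V=\{1,\dots,K\}$. For $i\in\mathcal V$, $V_i=\{i\}\cup\{j\in\mathcal V:(i,j)\in\mathcal E\}$ is the closed neighbourhood of $i$, and $|V_i|$ is its cardinality. Time is slotted, $n=0,1,2,\dots$. The arrival vectors $A(n)=(A_1(n),\dots,A_K(n))\in\mathbb N^K$ (with $\mathbb N=\{0,1,2,\dots\}$) form an i.i.d. sequence in $n$ (coordinates may be dependent), with $\mathbf E A_i(n)=\lambda_i\in(0,\infty)$. $W_i(n)$ is the number of users at vertex $i$ at time $n$. Given $W(n)$, the numbers $N_i(n)$ of users attempting transmission are independent over $i$, $N_i(n)$ being binomial with parameters $\bigl(W_i(n),1/\sum_{j\in V_i}W_j(n)\bigr)$ (and $N_i(n)=0$ if $W_i(n)=0$), and $$W_i(n)=W_i(n-1)+A_i(n)-\mathbf 1\{N_i(n-1)=1\}\prod_{j\in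 V_i\setminus\{i\}}\mathbf 1\{N_j(n-1)=0\}.$$ $W^x$ denotes this Markov chain on $\mathbb N^K$ with $W(0)=x$; the chains $W^x$, $x\in\mathbb N^K$, are defined on a common probability space and driven by the same arrivals. Fluid limits. $|x|=\sum_{k=1}^K|x_k|$ for $x\in\mathbb R^K$. For a sequence $x^n\in\mathbb N^K$ with $|x^n|\to\infty$ put $X^n(t)=W^{x^n}(\lceil|x^n|t\rceil)/|x^n|$, $t\ge0$. A fluid limit is any accumulation point $z$, in the Skorokhod topology on $\mathbb R^K$-valued c\`adl\`ag functions on $[0,\infty)$, of such a sequence $(X^n)$ (almost surely $(X^n)$ has compact closure). At any time $t$ at which $\sum_{j\in V_i}z_j(t)>0$ for all $i$, a fluid limit is (right-, if $t=0$) differentiable with $z_i'(t)=\lambda_i-\varphi_i(t)e^{-\sum_{j\in V_i}\varphi_j(t)}$, $\varphi_i(t)=z_i(t)/\sum_{j\in V_i}z_j(t)$. *)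

theory Defs
  imports "HOL-Probability.Probability"
begin

section \<open>The medium access model\<close>

text \<open>The vertex set is the finite type \<^typ>\<open>'k\<close>; the edge set \<open>E\<close> is a relation on it,
  assumed symmetric and connected in the locale below.\<close>

definition closed_nbhd :: "('k \<times> 'k) set \<Rightarrow> 'k \<Rightarrow> 'k set" where
  "closed_nbhd E i = {i} \<union> {j. (i, j) \<in> E}"

definition success :: "('k::finite \<times> 'k) set \<Rightarrow> nat ^ 'k \<Rightarrow> 'k \<Rightarrow> nat" where
  "success E v i =
     of_bool (v $ i = 1) * (\<Prod>j\<in>closed_nbhd E i - {i}. of_bool (v $ j = 0))"

text \<open>The queue lengths driven by arrivals \<open>a 1, a 2, \<dots>\<close> and attempts \<open>v 0, v 1, \<dots>\<close>.
  The subtraction on \<^typ>\<open>nat\<close> is harmless: almost surely no more than \<open>W\<^sub>i(n)\<close> users attempt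
  transmission at vertex \<open>i\<close>, so a success there forces \<open>W\<^sub>i(n) \<ge> 1\<close>.\<close>

primrec queue ::
  "('k::finite \<times> 'k) set \<Rightarrow> (nat \<Rightarrow> nat ^ 'k) \<Rightarrow> (nat \<Rightarrow> nat ^ 'k) \<Rightarrow> nat ^ 'k \<Rightarrow> nat \<Rightarrow> nat ^ 'k"
where
  "queue E a v x 0 = x"
| "queue E a v x (Suc n) =
     (\<chi> i. queue E a v x n $ i + a (Suc n) $ i - success E (v n) i)"

text \<open>\<open>N x n\<close> is the vector of attempts at time \<open>n\<close> of the chain started in \<open>x\<close>; the arrivals
  \<open>A n\<close> are common to all chains. No assumption is made on the joint law of the attempts of
  chains with different initial states.\<close>

locale medium_access = prob_space M
  for M :: "'w measure" +
  fixes E :: "('k::finite \<times> 'k) set"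
    and rate :: "'k \<Rightarrow> real"
    and A :: "nat \<Rightarrow> 'w \<Rightarrow> nat ^ 'k"
    and N :: "nat ^ 'k \<Rightarrow> nat \<Rightarrow> 'w \<Rightarrow> nat ^ 'k"
  assumes undirected: "sym E"
    and connected_graph: "\<And>i j. (i, j) \<in> E\<^sup>*"
    and rate_pos: "\<And>i. 0 < rate i"
    and arrivals_indep: "indep_vars (\<lambda>_. count_space UNIV) A UNIV"
    and arrivals_ident: "\<And>n. distr M (count_space UNIV) (A n) = distr M (count_space UNIV) (A 0)"
    and arrivals_integrable: "\<And>n i. integrable M (\<lambda>\<omega>. real (A n \<omega> $ i))"
    and arrivals_mean: "\<And>n i. expectation (\<lambda>\<omega>. real (A n \<omega> $ i)) = rate i"
    and attempts_measurable: "\<And>x n. N x n \<in> measurable M (count_space UNIV)"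
    \<comment> \<open>Given the past up to time \<open>n\<close>, the attempts at time \<open>n\<close> are independent binomials with
        parameters determined by \<open>W(n)\<close>; multiplied out to avoid conditioning on null events.\<close>
    and attempts_law: "\<And>x n h w v.
      prob {\<omega> \<in> space M.
              (map (\<lambda>k. A k \<omega>) [1..<Suc n], map (\<lambda>k. N x k \<omega>) [0..<n]) = h \<and>
              queue E (\<lambda>k. A k \<omega>) (\<lambda>k. N x k \<omega>) x n = w \<and> N x n \<omega> = v} =
      prob {\<omega> \<in> space M.
              (map (\<lambda>k. A k \<omega>) [1..<Suc n], map (\<lambda>k. N x k \<omega>) [0..<n]) = h \<and>
              queue E (\<lambda>k. A k \<omega>) (\<lambda>k. N x k \<omega>) x n = w} *
      (\<Prod>i\<in>UNIV. pmf (binomial_pmf (w $ i) (1 / (\<Sum>j\<in>closed_nbhd E i. real (w $ j)))) (v $ i))"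
    \<comment> \<open>Both variables are countably valued, so independence is a matter of their atoms.\<close>
    and arrivals_indep_past: "\<And>x n a h.
      indep_event {\<omega> \<in> space M. A (Suc n) \<omega> = a}
        {\<omega> \<in> space M.
           (map (\<lambda>k. A k \<omega>) [1..<Suc n], map (\<lambda>k. N x k \<omega>) [0..<Suc n]) = h}"


section \<open>Skorokhod topology on paths indexed by \<open>[0,\<infinity>)\<close>\<close>

text \<open>Paths are functions on \<^typ>\<open>real\<close>, of which only the values on \<open>[0,\<infinity>)\<close> matter.\<close>

definition cadlag :: "(real \<Rightarrow> 'a::topological_space) \<Rightarrow> bool" where
  "cadlag f \<longleftrightarrow>
     (\<forall>t\<ge>0. (f \<longlongrightarrow> f t) (at_right t)) \<and> (\<forall>t>0. \<exists>l. (f \<longlongrightarrow> l) (at_left t))"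

text \<open>Strictly increasing bijections of \<open>[0,\<infinity>)\<close>; these are automatically homeomorphisms.\<close>

definition time_change :: "(real \<Rightarrow> real) \<Rightarrow> bool" where
  "time_change \<mu> \<longleftrightarrow> strict_mono_on {0..} \<mu> \<and> \<mu> ` {0..} = {0..}"

definition skorokhod_nbhd :: "real \<Rightarrow> real \<Rightarrow> (real \<Rightarrow> 'a::metric_space) \<Rightarrow> (real \<Rightarrow> 'a) set" where
  "skorokhod_nbhd T \<epsilon> f =
     {g. \<exists>\<mu>. time_change \<mu> \<and> (\<forall>s\<ge>0. \<bar>\<mu> s - s\<bar> < \<epsilon>) \<and> (\<forall>s\<in>{0..T}. dist (g (\<mu> s)) (f s) < \<epsilon>)}"

text \<open>The J1 topology, with the sets \<^const>\<open>skorokhod_nbhd\<close> as neighbourhood bases. Thus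
  \<open>f\<^sub>n\<close> converges to \<open>f\<close> iff there are time changes \<open>\<mu>\<^sub>n\<close> with \<open>sup\<^sub>s |\<mu>\<^sub>n(s) - s| \<longlongrightarrow> 0\<close> and
  \<open>sup\<^bsub>s \<le> T\<^esub> |f\<^sub>n(\<mu>\<^sub>n(s)) - f(s)| \<longlongrightarrow> 0\<close> for all \<open>T\<close>. The usual Skorokhod space is the subspace of
  cadlag paths. All paths are admitted here because the scaled path \<open>W(\<lceil>m t\<rceil>) / m\<close> is
  left-continuous, not right-continuous, at its jumps.\<close>

definition skorokhod_topology :: "(real \<Rightarrow> 'a::metric_space) topology" where
  "skorokhod_topology =
     topology (\<lambda>U. \<forall>f\<in>U. \<exists>T \<epsilon>. \<epsilon> > 0 \<and> skorokhod_nbhd T \<epsilon> f \<subseteq> U)"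

lemma skorokhod_nbhd_mono:
  "T \<le> T' \<Longrightarrow> \<epsilon>' \<le> \<epsilon> \<Longrightarrow> skorokhod_nbhd T' \<epsilon>' f \<subseteq> skorokhod_nbhd T \<epsilon> f"
  unfolding skorokhod_nbhd_def by (clarsimp, metis atLeastAtMost_iff order_trans less_le_trans)

lemma openin_skorokhod:
  "openin skorokhod_topology U \<longleftrightarrow>
     (\<forall>f\<in>U. \<exists>T \<epsilon>. \<epsilon> > 0 \<and> skorokhod_nbhd T \<epsilon> f \<subseteq> (U :: (real \<Rightarrow> 'a::metric_space) set))"
proof -
  have "istopology (\<lambda>U :: (real \<Rightarrow> 'a) set. \<forall>f\<in>U. \<exists>T \<epsilon>. \<epsilon> > 0 \<and> skorokhod_nbhd T \<epsilon> f \<subseteq> U)"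
    unfolding istopology_def
  proof (intro conjI allI impI ballI)
    fix U V :: "(real \<Rightarrow> 'a) set" and f
    assume U: "\<forall>f\<in>U. \<exists>T \<epsilon>. \<epsilon> > 0 \<and> skorokhod_nbhd T \<epsilon> f \<subseteq> U"
      and V: "\<forall>f\<in>V. \<exists>T \<epsilon>. \<epsilon> > 0 \<and> skorokhod_nbhd T \<epsilon> f \<subseteq> V" and f: "f \<in> U \<inter> V"
    obtain T \<epsilon> where 1: "\<epsilon> > 0" "skorokhod_nbhd T \<epsilon> f \<subseteq> U" using U f by blast
    obtain T' \<epsilon>' where 2: "\<epsilon>' > 0" "skorokhod_nbhd T' \<epsilon>' f \<subseteq> V" using V f by blast
    have "skorokhod_nbhd (max T T') (min \<epsilon> \<epsilon>') f \<subseteq> U \<inter> V"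
      using 1(2) 2(2) skorokhod_nbhd_mono[of T "max T T'" "min \<epsilon> \<epsilon>'" \<epsilon> f]
        skorokhod_nbhd_mono[of T' "max T T'" "min \<epsilon> \<epsilon>'" \<epsilon>' f] by auto
    then show "\<exists>T \<epsilon>. \<epsilon> > 0 \<and> skorokhod_nbhd T \<epsilon> f \<subseteq> U \<inter> V"
      using 1(1) 2(1) by (intro exI[of _ "max T T'"] exI[of _ "min \<epsilon> \<epsilon>'"]) simp
  next
    fix \<U> :: "(real \<Rightarrow> 'a) set set" and f
    assume "\<forall>U\<in>\<U>. \<forall>f\<in>U. \<exists>T \<epsilon>. \<epsilon> > 0 \<and> skorokhod_nbhd T \<epsilon> f \<subseteq> U" "f \<in> \<Union>\<U>"
    then show "\<exists>T \<epsilon>. \<epsilon> > 0 \<and> skorokhod_nbhd T \<epsilon> f \<subseteq> \<Union>\<U>"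
      by (meson Union_upper UnionE order_trans)
  qed
  then show ?thesis
    by (simp add: skorokhod_topology_def)
qed

lemma skorokhod_nbhd_trans:
  assumes "g \<in> skorokhod_nbhd (T + \<delta>) \<delta> f'" and "f' \<in> skorokhod_nbhd T \<epsilon> f"
    and "0 < \<epsilon>" and "\<epsilon> \<le> \<delta>"
  shows "g \<in> skorokhod_nbhd T (\<epsilon> + \<delta>) f"
proof -
  obtain \<mu> where \<mu>: "strict_mono_on {0..} \<mu>" "\<mu> ` {0..} = {0..}" "\<And>s. s \<ge> 0 \<Longrightarrow> \<bar>\<mu> s - s\<bar> < \<delta>"
    "\<And>s. s \<in> {0..T + \<delta>} \<Longrightarrow> dist (g (\<mu> s)) (f' s) < \<delta>"
    using assms(1) unfolding skorokhod_nbhd_def time_change_def by blast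
  obtain \<nu> where \<nu>: "strict_mono_on {0..} \<nu>" "\<nu> ` {0..} = {0..}" "\<And>s. s \<ge> 0 \<Longrightarrow> \<bar>\<nu> s - s\<bar> < \<epsilon>"
    "\<And>s. s \<in> {0..T} \<Longrightarrow> dist (f' (\<nu> s)) (f s) < \<epsilon>"
    using assms(2) unfolding skorokhod_nbhd_def time_change_def by blast
  have nonneg: "\<nu> s \<ge> 0" if "s \<ge> 0" for s using \<nu>(2) that by auto
  have "time_change (\<mu> \<circ> \<nu>)"
    unfolding time_change_def
  proof
    show "strict_mono_on {0..} (\<mu> \<circ> \<nu>)"
      using \<mu>(1) \<nu>(1) nonneg by (auto simp: strict_mono_on_def)
    show "(\<mu> \<circ> \<nu>) ` {0..} = {0..}" using \<mu>(2) \<nu>(2) by (metis image_comp)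
  qed
  moreover have "\<bar>(\<mu> \<circ> \<nu>) s - s\<bar> < \<epsilon> + \<delta>" if "s \<ge> 0" for s
    using \<mu>(3)[OF nonneg[OF that]] \<nu>(3)[OF that] by simp
  moreover have "dist (g ((\<mu> \<circ> \<nu>) s)) (f s) < \<epsilon> + \<delta>" if s: "s \<in> {0..T}" for s
  proof -
    have "\<nu> s \<in> {0..T + \<delta>}" using \<nu>(3)[of s] nonneg[of s] s assms(4) by auto
    then show ?thesis
      using \<mu>(4)[of "\<nu> s"] \<nu>(4)[OF s] dist_triangle[of "g (\<mu> (\<nu> s))" "f s" "f' (\<nu> s)"] by simp
  qed
  ultimately show ?thesis unfolding skorokhod_nbhd_def by blast
qed

lemma skorokhod_nbhd_refl: "0 < \<epsilon> \<Longrightarrow> f \<in> skorokhod_nbhd T \<epsilon> f"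
  unfolding skorokhod_nbhd_def time_change_def
  by (auto intro!: exI[of _ "\<lambda>s. s"] simp: strict_mono_on_def)

lemma skorokhod_nbhd_open:
  assumes "0 < \<epsilon>"
  shows "\<exists>U. openin skorokhod_topology U \<and> f \<in> U \<and> U \<subseteq> skorokhod_nbhd T \<epsilon> f"
proof (intro exI conjI)
  let ?U = "{g. \<exists>S \<delta>. 0 < \<delta> \<and> skorokhod_nbhd S \<delta> g \<subseteq> skorokhod_nbhd T \<epsilon> f}"
  show "f \<in> ?U" using assms by blast
  show "?U \<subseteq> skorokhod_nbhd T \<epsilon> f" using skorokhod_nbhd_refl by blast
  show "openin skorokhod_topology ?U"
    unfolding openin_skorokhod
  proof
    fix g assume "g \<in> ?U"
    then obtain S \<delta> where S: "0 < \<delta>" "skorokhod_nbhd S \<delta> g \<subseteq> skorokhod_nbhd T \<epsilon> f" by blast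
    have "skorokhod_nbhd (S + \<delta> / 2) (\<delta> / 2) h \<subseteq> skorokhod_nbhd T \<epsilon> f"
      if "h \<in> skorokhod_nbhd S (\<delta> / 2) g" for h
      using S skorokhod_nbhd_trans[OF _ that, of _ "\<delta> / 2"] by fastforce
    then have "skorokhod_nbhd S (\<delta> / 2) g \<subseteq> ?U" using S(1) half_gt_zero by blast
    then show "\<exists>T \<epsilon>. \<epsilon> > 0 \<and> skorokhod_nbhd T \<epsilon> g \<subseteq> ?U" using S(1) half_gt_zero by blast
  qed
qed


section \<open>Fluid limits\<close>

definition l1_norm :: "real ^ 'k::finite \<Rightarrow> real" where
  "l1_norm x = (\<Sum>k\<in>UNIV. \<bar>x $ k\<bar>)"

definition real_vec :: "nat ^ 'k::finite \<Rightarrow> real ^ 'k" where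
  "real_vec x = (\<chi> i. real (x $ i))"

definition fluid_scaling :: "real \<Rightarrow> (nat \<Rightarrow> nat ^ 'k::finite) \<Rightarrow> real \<Rightarrow> real ^ 'k" where
  "fluid_scaling m w t = (1 / m) *\<^sub>R real_vec (w (nat \<lceil>m * t\<rceil>))"

text \<open>The fluid limits along the realisation given by arrivals \<open>a\<close> and attempts \<open>v x\<close> of the
  chain started in \<open>x\<close>, over all sequences of initial states whose norms tend to infinity.\<close>

definition fluid_limit ::
  "('k::finite \<times> 'k) set \<Rightarrow> (nat \<Rightarrow> nat ^ 'k) \<Rightarrow> (nat ^ 'k \<Rightarrow> nat \<Rightarrow> nat ^ 'k) \<Rightarrow>
   (real \<Rightarrow> real ^ 'k) \<Rightarrow> bool"
where
  "fluid_limit E a v z \<longleftrightarrow> cadlag z \<and>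
     (\<exists>x. filterlim (\<lambda>n. l1_norm (real_vec (x n))) at_top sequentially \<and>
          (\<forall>U. openin skorokhod_topology U \<and> z \<in> U \<longrightarrow>
             (\<exists>\<^sub>F n in sequentially.
                fluid_scaling (l1_norm (real_vec (x n))) (queue E a (v (x n)) (x n)) \<in> U)))"

end

theory Submission
  imports Defs "HOL-Real_Asymp.Real_Asymp"
begin

text \<open>Summing the dynamics, \<open>W(n)\<close> is the initial state plus accumulated arrivals minus accumulated
  successes. The arrivals follow the strong law of large numbers. The successes minus their
  conditional probabilities form a martingale with bounded increments, so for the chain started in
  \<open>x\<close> a deviation of order \<open>|x|\<close> before a time of order \<open>|x|\<close> has probability exponentially small in
  \<open>|x|\<close>; as there are only polynomially many \<open>x\<close> with \<open>|x| = m\<close>, Borel--Cantelli gives almost surely a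
  uniform bound over all initial states at once, without any assumption on their coupling. On this
  event every fluid limit is Lipschitz, and since the success probabilities converge to
  \<open>\<phi>\<^sub>i exp (- \<Sum>\<^bsub>j\<in>V\<^sub>i\<^esub> \<phi>\<^sub>j)\<close> by the Poisson limit of the binomial law, it satisfies the fluid
  equation wherever all coordinates are positive. The bound on the derivative is then an inequality
  for positive vectors, proved by convexity of \<open>exp\<close>.\<close>


section \<open>The strong law of large numbers\<close>

text \<open>The exceptional null set must be fixed before the fluid limit: the sequence of initial
  states and the accumulation point range over uncountable sets and may depend on the realisation.
  All probability is therefore packed into the properties of one realisation listed in
  \<open>fluid_realisation\<close>, and what follows from them is deterministic. Two points shape
  the rest. Only a finite mean of the arrivals is assumed, so their law of large numbers goes
  through truncation, whereas successes are bounded and admit exponential bounds strong enough for a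
  union over initial states. And the scaled paths approach the limit only up to a time change; the
  Lipschitz bound is there to turn Skorokhod closeness into uniform closeness on compact intervals.
  Then all states visited near time \<open>t\<close> have nearly the same success probability,
  positivity keeping the denominators of order \<open>|x|\<close>, and the increments of the queue
  exhibit the derivative directly, without an integral equation for the limit.\<close>

lemma sum_dyadic_exceedance_le:
  fixes R :: real
  assumes "0 \<le> R"
  shows "(\<Sum>r<n. 2 ^ r * of_bool (2 ^ r < R)) \<le> 2 * R"
proof (induction n)
  case (Suc n)
  have geom: "(\<Sum>r<Suc n. 2 ^ r :: real) = 2 ^ Suc n - 1" for n
    by (induction n) auto
  show ?case
  proof (cases "2 ^ n < R")
    \<comment> \<open>The top level alone controls the whole geometric sum:
      \<open>2 ^ Suc n - 1\<close> is below \<open>2 * 2 ^ n\<close>, hence below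
      \<open>2 * R\<close>.\<close>
    case True
    have "(\<Sum>r<Suc n. 2 ^ r * of_bool (2 ^ r < R)) \<le> (\<Sum>r<Suc n. 2 ^ r :: real)"
      by (intro sum_mono) auto
    also have "\<dots> \<le> 2 * R" unfolding geom using True by simp
    finally show ?thesis .
  qed (use Suc in simp)
qed (use assms in simp)

text \<open>The nonzero terms form a geometric series that starts at the first power of two above
  \<open>R\<close>, where the term is at most \<open>R\<close>. In expectation, this bound and the
  previous one control truncated second moments and exceedance probabilities by the first moment
  alone.\<close>

lemma sum_dyadic_truncated_square_le:
  fixes R :: real
  assumes "0 \<le> R"
  shows "(\<Sum>r<n. R\<^sup>2 / 2 ^ r * of_bool (R \<le> 2 ^ r)) \<le> 2 * R"
proof -
  have zero: "(\<Sum>r<n. R\<^sup>2 / 2 ^ r * of_bool (R \<le> 2 ^ r)) = 0" if "2 ^ n < R" for n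
  proof (intro sum.neutral ballI)
    fix r assume "r \<in> {..<n}"
    then have "(2::real) ^ r \<le> 2 ^ n" by (intro power_increasing) auto
    then have "\<not> R \<le> 2 ^ r" using that by linarith
    then show "R\<^sup>2 / 2 ^ r * of_bool (R \<le> 2 ^ r) = 0" by simp
  qed
  \<comment> \<open>The subtracted term is the tail of the series still to come; it shrinks by
    exactly the summand that is added, so the induction closes.\<close>
  have step: "(\<Sum>r<n. R\<^sup>2 / 2 ^ r * of_bool (R \<le> 2 ^ r)) \<le> 2 * R - 2 * R\<^sup>2 / 2 ^ n" if "R \<le> 2 ^ n"
    using that
  proof (induction n)
    case 0
    then show ?case using assms by (simp add: power2_eq_square mult_left_le_one_le)
  next
    case (Suc n)
    show ?case
    proof (cases "R \<le> 2 ^ n")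
      case True
      have "2 * R\<^sup>2 / 2 ^ Suc n = R\<^sup>2 / 2 ^ n" "2 * R\<^sup>2 / 2 ^ n = 2 * (R\<^sup>2 / 2 ^ n)" by auto
      then show ?thesis using Suc.IH[OF True] True by simp
    next
      case False
      have "R\<^sup>2 / 2 ^ Suc n \<le> R"
        using mult_left_mono[OF Suc.prems assms] by (simp add: power2_eq_square divide_simps)
      then show ?thesis using zero[of n] False by simp
    qed
  qed
  have nonneg: "0 \<le> 2 * R\<^sup>2 / 2 ^ n" by simp
  show ?thesis
  proof (cases "R \<le> 2 ^ n")
    case True
    show ?thesis using step[OF True] nonneg by linarith
  next
    case False
    then show ?thesis using zero[of n] assms by linarith
  qed
qed

section \<open>Laws of large numbers for i.i.d. variables\<close>

context prob_space
begin

text \<open>Square integrability is carried along because the inductive step expands the variance of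
  the partial sum into second moments.\<close>

lemma variance_sum_indep:
  assumes "finite I" "indep_vars (\<lambda>_. borel) X I"
    and "\<And>i. i \<in> I \<Longrightarrow> integrable M (\<lambda>\<omega>. (X i \<omega> :: real)\<^sup>2)"
  shows "integrable M (\<lambda>\<omega>. (\<Sum>i\<in>I. X i \<omega>)\<^sup>2) \<and>
         variance (\<lambda>\<omega>. \<Sum>i\<in>I. X i \<omega>) = (\<Sum>i\<in>I. variance (X i))"
  using assms
proof (induction I rule: finite_induct)
  case empty
  then show ?case by simp
next
  case (insert i I)
  define S where "S = (\<lambda>\<omega>. \<Sum>j\<in>I. X j \<omega>)"
  have rv: "random_variable borel (X j)" if "j \<in> insert i I" for j
    using insert.prems(1) that unfolding indep_vars_def by blast
  then have rvS [measurable]: "random_variable borel S"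
    unfolding S_def by (intro borel_measurable_sum) auto
  have [measurable]: "random_variable borel (X i)" using rv by simp
  have IH: "integrable M (\<lambda>\<omega>. (S \<omega>)\<^sup>2)" "variance S = (\<Sum>i\<in>I. variance (X i))"
    using insert.IH insert.prems indep_vars_subset[OF insert.prems(1), of I]
    by (auto simp: S_def)
  have X2: "integrable M (\<lambda>\<omega>. (X i \<omega>)\<^sup>2)" using insert.prems by simp
  have X1: "integrable M (X i)" and S1: "integrable M S"
    using X2 IH(1) by (auto intro!: square_integrable_imp_integrable)
  have ind: "indep_var borel (X i) borel S"
    unfolding S_def using insert by (intro indep_vars_sum) auto
  have XS: "integrable M (\<lambda>\<omega>. X i \<omega> * S \<omega>)"
    and eXS: "expectation (\<lambda>\<omega>. X i \<omega> * S \<omega>) = expectation (X i) * expectation S"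
    using indep_var_integrable[OF ind X1 S1] indep_var_lebesgue_integral[OF ind X1 S1] by auto
  have sq: "(X i \<omega> + S \<omega>)\<^sup>2 = (X i \<omega>)\<^sup>2 + 2 * (X i \<omega> * S \<omega>) + (S \<omega>)\<^sup>2" for \<omega>
    by (simp add: power2_eq_square algebra_simps)
  have int: "integrable M (\<lambda>\<omega>. (X i \<omega> + S \<omega>)\<^sup>2)"
    unfolding sq using XS X2 IH(1) by auto
  have "variance (\<lambda>\<omega>. X i \<omega> + S \<omega>) =
      expectation (\<lambda>\<omega>. (X i \<omega> + S \<omega>)\<^sup>2) - (expectation (X i) + expectation S)\<^sup>2"
    using X1 S1 int by (subst variance_eq) auto
  also have "\<dots> = variance (X i) + variance S"
  proof -
    have "expectation (\<lambda>\<omega>. (X i \<omega> + S \<omega>)\<^sup>2) = expectation (\<lambda>\<omega>. (X i \<omega>)\<^sup>2)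
        + 2 * (expectation (X i) * expectation S) + expectation (\<lambda>\<omega>. (S \<omega>)\<^sup>2)"
      unfolding sq using XS X2 IH(1) by (simp add: eXS)
    moreover have "variance (X i) = expectation (\<lambda>\<omega>. (X i \<omega>)\<^sup>2) - (expectation (X i))\<^sup>2"
      "variance S = expectation (\<lambda>\<omega>. (S \<omega>)\<^sup>2) - (expectation S)\<^sup>2"
      using X1 S1 X2 IH(1) by (auto intro: variance_eq)
    ultimately show ?thesis by (simp only:) (simp add: power2_sum)
  qed
  finally show ?case
    using int insert.hyps IH(2) by (simp add: S_def)
qed

lemma expectation_identically_distributed:
  fixes g :: "real \<Rightarrow> real"
  assumes "distr M borel X = distr M borel Y"
    and [measurable]: "random_variable borel X" "random_variable borel Y" "g \<in> borel_measurable borel"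
  shows "expectation (\<lambda>\<omega>. g (X \<omega>)) = expectation (\<lambda>\<omega>. g (Y \<omega>))"
  using assms(1) integral_distr[of X M borel g] integral_distr[of Y M borel g] by simp

lemma distr_compose_identically_distributed:
  fixes g :: "real \<Rightarrow> real"
  assumes "distr M borel X = distr M borel Y"
    and [measurable]: "random_variable borel X" "random_variable borel Y" "g \<in> borel_measurable borel"
  shows "distr M borel (\<lambda>\<omega>. g (X \<omega>)) = distr M borel (\<lambda>\<omega>. g (Y \<omega>))"
  using distr_distr[of g borel borel X M] distr_distr[of g borel borel Y M] assms(1)
  by (simp add: comp_def)

text \<open>The factor 4 lost here is harmless in the strong law, where the bound is applied
  to remainders of arbitrarily small expectation.\<close>

lemma iid_nonneg_sum_eventually_le:
  fixes R :: "nat \<Rightarrow> 'a \<Rightarrow> real"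
  assumes ind: "indep_vars (\<lambda>_. borel) R UNIV"
    and ident: "\<And>k. distr M borel (R k) = distr M borel (R 0)"
    and nonneg: "\<And>k \<omega>. 0 \<le> R k \<omega>"
    and int: "integrable M (R 0)" and d: "expectation (R 0) < d"
  shows "AE \<omega> in M. \<forall>\<^sub>F n in sequentially. (\<Sum>k<n. R k \<omega>) \<le> 4 * d * n"
proof -
  have rv [measurable]: "random_variable borel (R k)" for k
    using ind unfolding indep_vars_def by blast
  have "0 \<le> expectation (R 0)" using nonneg by simp
  then have d0: "0 < d" using d by simp
  define U where "U r k \<omega> = R k \<omega> * of_bool (R k \<omega> \<le> 2 ^ r)" for r k \<omega>
  have U_le: "U r k \<omega> \<le> 2 ^ r" and U_nonneg: "0 \<le> U r k \<omega>" and U_le_R: "U r k \<omega> \<le> R k \<omega>" for r k \<omega>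
    using nonneg[of k \<omega>] by (auto simp: U_def)
  have U_rv [measurable]: "random_variable borel (U r k)" for r k
    unfolding U_def by measurable
  have U_ind: "indep_vars (\<lambda>_. borel) (U r) J" for r J
    unfolding U_def
    by (rule indep_vars_compose2[OF indep_vars_subset[OF ind subset_UNIV]]) measurable
  have U_int: "integrable M (U r k)" for r k
    using U_le U_nonneg by (intro integrable_const_bound[of _ "2 ^ r"]) auto
  have U2_int: "integrable M (\<lambda>\<omega>. (U r k \<omega>)\<^sup>2)" for r k
    using U_le U_nonneg
    by (intro integrable_const_bound[of _ "(2 ^ r)\<^sup>2"]) (auto intro!: power_mono)
  \<comment> \<open>\<open>p r\<close> is the union bound for some of the first \<open>2 ^ r\<close>
    variables exceeding \<open>2 ^ r\<close>; \<open>q r\<close> is the scaled second moment that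
    Chebyshev's inequality produces for the truncated ones. The dyadic lemmas make both
    summable.\<close>
  define p :: "nat \<Rightarrow> real" where "p r = expectation (\<lambda>\<omega>. 2 ^ r * of_bool (2 ^ r < R 0 \<omega>))" for r
  define q where "q r = expectation (\<lambda>\<omega>. (R 0 \<omega>)\<^sup>2 / 2 ^ r * of_bool (R 0 \<omega> \<le> 2 ^ r))" for r
  have U2: "(R k \<omega>)\<^sup>2 / 2 ^ r * of_bool (R k \<omega> \<le> 2 ^ r) = (U r k \<omega>)\<^sup>2 / 2 ^ r" for r k \<omega>
    by (auto simp: U_def)
  have p_int: "integrable M (\<lambda>\<omega>. 2 ^ r * of_bool (2 ^ r < R 0 \<omega>) :: real)" for r
    by (intro integrable_const_bound[of _ "2 ^ r"]) auto
  have q_int: "integrable M (\<lambda>\<omega>. (R 0 \<omega>)\<^sup>2 / 2 ^ r * of_bool (R 0 \<omega> \<le> 2 ^ r))" for r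
    unfolding U2 using U2_int by simp
  have sum_p: "summable p"
  proof (rule summableI_nonneg_bounded)
    show "0 \<le> p r" for r unfolding p_def by simp
    fix n
    have "(\<Sum>r<n. p r) = expectation (\<lambda>\<omega>. \<Sum>r<n. 2 ^ r * of_bool (2 ^ r < R 0 \<omega>))"
      unfolding p_def by (rule Bochner_Integration.integral_sum[symmetric]) (rule p_int)
    also have "\<dots> \<le> expectation (\<lambda>\<omega>. 2 * R 0 \<omega>)"
      by (intro integral_mono sum_dyadic_exceedance_le nonneg Bochner_Integration.integrable_sum p_int
          integrable_mult_right int)
    finally show "(\<Sum>r<n. p r) \<le> expectation (\<lambda>\<omega>. 2 * R 0 \<omega>)" .
  qed
  have sum_q: "summable q"
  proof (rule summableI_nonneg_bounded)
    show "0 \<le> q r" for r unfolding q_def by simp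
    fix n
    have "(\<Sum>r<n. q r) =
        expectation (\<lambda>\<omega>. \<Sum>r<n. (R 0 \<omega>)\<^sup>2 / 2 ^ r * of_bool (R 0 \<omega> \<le> 2 ^ r))"
      unfolding q_def by (rule Bochner_Integration.integral_sum[symmetric]) (rule q_int)
    also have "\<dots> \<le> expectation (\<lambda>\<omega>. 2 * R 0 \<omega>)"
      by (intro integral_mono sum_dyadic_truncated_square_le nonneg Bochner_Integration.integrable_sum q_int
          integrable_mult_right int)
    finally show "(\<Sum>r<n. q r) \<le> expectation (\<lambda>\<omega>. 2 * R 0 \<omega>)" .
  qed
  define B where "B r = {\<omega> \<in> space M. 2 * d * 2 ^ r < (\<Sum>k<2 ^ r. R k \<omega>)}" for r :: nat
  have B_meas [measurable]: "B r \<in> events" for r unfolding B_def by measurable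
  have B_le: "prob (B r) \<le> p r + q r / d\<^sup>2" for r
  proof -
    let ?C = "\<lambda>k. {\<omega> \<in> space M. 2 ^ r < R k \<omega>}"
    let ?S = "\<lambda>\<omega>. \<Sum>k<2 ^ r. U r k \<omega>"
    let ?D = "{\<omega> \<in> space M. d * 2 ^ r \<le> \<bar>?S \<omega> - expectation ?S\<bar>}"
    have EU: "expectation (U r k) \<le> d" for k
    proof -
      have "expectation (U r k) = expectation (U r 0)"
        unfolding U_def
        by (rule expectation_identically_distributed[OF ident rv rv, where g = "\<lambda>x. x * of_bool (x \<le> 2 ^ r)"]) simp
      also have "\<dots> \<le> expectation (R 0)"
        using U_le_R by (intro integral_mono U_int int) auto
      finally show ?thesis using d by simp
    qed
    have ES: "expectation ?S \<le> d * 2 ^ r"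
      using U_int sum_mono[of "{..<2 ^ r :: nat}" "\<lambda>k. expectation (U r k)" "\<lambda>_. d"] EU by (simp add: mult.commute)
    \<comment> \<open>Without an exceedance the truncated sum equals the full sum, and its mean is
      at most \<open>d * 2 ^ r\<close>, so passing \<open>2 * d * 2 ^ r\<close> is a deviation of at
      least \<open>d * 2 ^ r\<close>.\<close>
    have "B r \<subseteq> (\<Union>k<2 ^ r. ?C k) \<union> ?D"
    proof
      fix \<omega> assume \<omega>: "\<omega> \<in> B r"
      show "\<omega> \<in> (\<Union>k<2 ^ r. ?C k) \<union> ?D"
      proof (cases "\<exists>k<2 ^ r. 2 ^ r < R k \<omega>")
        case True
        then show ?thesis using \<omega> by (auto simp: B_def)
      next
        case False
        then have "?S \<omega> = (\<Sum>k<2 ^ r. R k \<omega>)" by (intro sum.cong) (auto simp: U_def)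
        then show ?thesis using \<omega> ES by (auto simp: B_def)
      qed
    qed
    then have "prob (B r) \<le> prob ((\<Union>k<2 ^ r. ?C k) \<union> ?D)"
      by (intro finite_measure_mono) auto
    also have "\<dots> \<le> prob (\<Union>k<2 ^ r. ?C k) + prob ?D"
      by (intro measure_Un_le) auto
    also have "prob (\<Union>k<2 ^ r. ?C k) \<le> (\<Sum>k<2 ^ r. prob (?C k))"
      by (intro measure_UNION_le) auto
    also have "\<dots> = (\<Sum>k<2 ^ r :: nat. prob (?C 0))"
    proof (intro sum.cong refl)
      fix k
      have C: "prob (?C k) = expectation (\<lambda>\<omega>. of_bool (2 ^ r < R k \<omega>))" for k
        by (subst Bochner_Integration.integral_cong[OF refl, of _ _ "indicator (?C k)"])
          (auto simp: indicator_def)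
      show "prob (?C k) = prob (?C 0)"
        unfolding C by (rule expectation_identically_distributed[OF ident rv rv, where g = "\<lambda>x. of_bool (2 ^ r < x)"]) simp
    qed
    also have "\<dots> = p r"
    proof -
      have "expectation (\<lambda>\<omega>. of_bool (2 ^ r < R 0 \<omega>)) = prob (?C 0)"
        by (subst Bochner_Integration.integral_cong[OF refl, of _ _ "indicator (?C 0)"])
          (auto simp: indicator_def)
      then show ?thesis by (simp add: p_def)
    qed
    also have "prob ?D \<le> variance ?S / (d * 2 ^ r)\<^sup>2"
      using variance_sum_indep[OF _ U_ind, of "{..<2 ^ r}" r] U2_int d0
      by (intro Chebyshev_inequality) auto
    also have "variance ?S = (\<Sum>k<2 ^ r. variance (U r k))"
      using variance_sum_indep[OF _ U_ind, of "{..<2 ^ r}" r] U2_int by auto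
    also have "\<dots> \<le> (\<Sum>k<2 ^ r :: nat. 2 ^ r * q r)"
    proof (intro sum_mono)
      fix k
      have "variance (U r k) \<le> expectation (\<lambda>\<omega>. (U r k \<omega>)\<^sup>2)"
        using U_int U2_int by (simp add: variance_eq)
      also have "\<dots> = expectation (\<lambda>\<omega>. (U r 0 \<omega>)\<^sup>2)"
        unfolding U_def
        by (rule expectation_identically_distributed[OF ident rv rv, where g = "\<lambda>x. (x * of_bool (x \<le> 2 ^ r))\<^sup>2"]) simp
      also have "\<dots> = 2 ^ r * q r"
        unfolding q_def U2 by simp
      finally show "variance (U r k) \<le> 2 ^ r * q r" .
    qed
    finally show ?thesis
      using d0 by (simp add: divide_right_mono power2_eq_square field_simps)
  qed
  have "AE \<omega> in M. \<forall>\<^sub>F r in sequentially. \<omega> \<in> space M - B r"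
  proof (rule borel_cantelli_AE1)
    show "summable (\<lambda>r. prob (B r))"
      by (rule summable_comparison_test[OF _ summable_add[OF sum_p summable_divide[OF sum_q, of "d\<^sup>2"]]])
        (use B_le in auto)
  qed (auto simp: emeasure_eq_measure)
  then show ?thesis
  proof (rule AE_mp, intro AE_I2 impI)
    fix \<omega> assume "\<omega> \<in> space M" "\<forall>\<^sub>F r in sequentially. \<omega> \<in> space M - B r"
    then obtain r0 where r0: "\<And>r. r0 \<le> r \<Longrightarrow> (\<Sum>k<2 ^ r. R k \<omega>) \<le> 2 * d * 2 ^ r"
      unfolding eventually_sequentially B_def by force
    \<comment> \<open>Partial sums of nonnegative terms are monotone, so the bound at the next power
      of two serves for \<open>n\<close>, at the price of a second factor 2.\<close>
    have "(\<Sum>k<n. R k \<omega>) \<le> 4 * d * n" if n: "2 ^ r0 \<le> n" for n :: nat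
    proof -
      have "1 \<le> n" using n by (metis le_trans one_le_numeral one_le_power)
      then obtain r where r: "2 ^ r \<le> n" "n < 2 ^ Suc r"
        using ex_power_ivl1[of 2 n] by auto
      have "(2::nat) ^ r0 < 2 ^ Suc r" using r n by linarith
      then have r_ge: "r0 \<le> Suc r" using power_less_imp_less_exp[of "2::nat" r0 "Suc r"] by simp
      have "(\<Sum>k<n. R k \<omega>) \<le> (\<Sum>k<2 ^ Suc r. R k \<omega>)"
        using r nonneg by (intro sum_mono2) auto
      also have "\<dots> \<le> 2 * d * 2 ^ Suc r" using r0[OF r_ge] .
      also have "\<dots> \<le> 4 * d * n"
      proof -
        have "real (2 ^ r) \<le> real n" using r(1) by (rule of_nat_mono)
        then show ?thesis using d0 by simp
      qed
      finally show ?thesis .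
    qed
    then show "\<forall>\<^sub>F n in sequentially. (\<Sum>k<n. R k \<omega>) \<le> 4 * d * n"
      unfolding eventually_sequentially by blast
  qed
qed

text \<open>Hoeffding's inequality makes the deviation probabilities geometric in \<open>n\<close>,
  so Borel-Cantelli applies along all \<open>n\<close> at once.\<close>

lemma iid_bounded_strong_law:
  fixes Y :: "nat \<Rightarrow> 'a \<Rightarrow> real"
  assumes ind: "indep_vars (\<lambda>_. borel) Y UNIV"
    and ident: "\<And>k. expectation (Y k) = expectation (Y 0)"
    and bound: "\<And>k \<omega>. \<bar>Y k \<omega>\<bar> \<le> c" and c: "0 < c"
  shows "AE \<omega> in M. (\<lambda>n. (\<Sum>k<n. Y k \<omega>) / n) \<longlonglongrightarrow> expectation (Y 0)"
proof -
  have rv [measurable]: "random_variable borel (Y k)" for k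
    using ind unfolding indep_vars_def by blast
  define \<mu> where "\<mu> = expectation (Y 0)"
  have mean: "expectation (Y k) = \<mu>" for k unfolding \<mu>_def by (rule ident)
  \<comment> \<open>Tolerances of the form \<open>1 / Suc j\<close> are countable in number, so
    their null sets can be united afterwards.\<close>
  have "AE \<omega> in M. \<forall>\<^sub>F n in sequentially. \<bar>(\<Sum>k<n. Y k \<omega>) / n - \<mu>\<bar> < 1 / Suc j" for j :: nat
  proof -
    define e where "e = 1 / real (Suc j)"
    have e: "0 < e" by (simp add: e_def)
    define B where "B n = {\<omega> \<in> space M. e * n \<le> \<bar>(\<Sum>k<n. Y k \<omega>) - n * \<mu>\<bar>}" for n
    have [measurable]: "B n \<in> events" for n unfolding B_def by measurable
    have B_le: "prob (B n) \<le> 2 * exp (- (e\<^sup>2 / (2 * c\<^sup>2))) ^ n" if "0 < n" for n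
    proof -
      interpret H: Hoeffding_ineq M "{..<n}" Y "\<lambda>_. - c" "\<lambda>_. c" "\<Sum>k<n. expectation (Y k)"
        by unfold_locales
          (use bound in \<open>auto intro!: indep_vars_subset[OF ind] simp: abs_le_iff minus_le_iff\<close>)
      have "prob (B n) \<le> 2 * exp (- 2 * (e * n)\<^sup>2 / (\<Sum>k<n. (c - - c)\<^sup>2))"
        using H.Hoeffding_ineq_abs_ge[of "e * n"] e c that
        by (simp add: B_def mean)
      also have "- 2 * (e * n)\<^sup>2 / (\<Sum>k<n. (c - - c)\<^sup>2) = real n * - (e\<^sup>2 / (2 * c\<^sup>2))"
        using that c by (simp add: power2_eq_square field_simps)
      also have "exp \<dots> = exp (- (e\<^sup>2 / (2 * c\<^sup>2))) ^ n"
        by (rule exp_of_nat_mult)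
      finally show ?thesis .
    qed
    have "AE \<omega> in M. \<forall>\<^sub>F n in sequentially. \<omega> \<in> space M - B n"
    proof (rule borel_cantelli_AE1)
      show "summable (\<lambda>n. prob (B n))"
      proof (rule summable_comparison_test)
        show "\<exists>N. \<forall>n\<ge>N. norm (prob (B n)) \<le> 2 * exp (- (e\<^sup>2 / (2 * c\<^sup>2))) ^ n"
          using B_le by (intro exI[of _ 1]) auto
        show "summable (\<lambda>n. 2 * exp (- (e\<^sup>2 / (2 * c\<^sup>2))) ^ n)"
          using e c by (intro summable_mult summable_geometric) simp
      qed
    qed (auto simp: emeasure_eq_measure)
    then show ?thesis
    proof (rule AE_mp, intro AE_I2 impI)
      fix \<omega> assume "\<omega> \<in> space M" "\<forall>\<^sub>F n in sequentially. \<omega> \<in> space M - B n"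
      from this(2) show "\<forall>\<^sub>F n in sequentially. \<bar>(\<Sum>k<n. Y k \<omega>) / n - \<mu>\<bar> < 1 / Suc j"
        using eventually_gt_at_top[of 0]
      proof eventually_elim
        case (elim n)
        have "\<bar>(\<Sum>k<n. Y k \<omega>) - n * \<mu>\<bar> < e * n" using elim by (auto simp: B_def)
        moreover have "(\<Sum>k<n. Y k \<omega>) / n - \<mu> = ((\<Sum>k<n. Y k \<omega>) - n * \<mu>) / n"
          using elim by (simp add: field_simps)
        ultimately show ?case using elim unfolding e_def[symmetric] by (simp add: divide_less_eq)
      qed
    qed
  qed
  then have "AE \<omega> in M. \<forall>j. \<forall>\<^sub>F n in sequentially. \<bar>(\<Sum>k<n. Y k \<omega>) / n - \<mu>\<bar> < 1 / Suc j"
    by (simp add: AE_all_countable)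
  then show ?thesis
  proof (rule AE_mp, intro AE_I2 impI)
    fix \<omega> assume *: "\<forall>j. \<forall>\<^sub>F n in sequentially. \<bar>(\<Sum>k<n. Y k \<omega>) / n - \<mu>\<bar> < 1 / Suc j"
    show "(\<lambda>n. (\<Sum>k<n. Y k \<omega>) / n) \<longlonglongrightarrow> expectation (Y 0)"
      unfolding tendsto_iff \<mu>_def[symmetric]
    proof (intro allI impI)
      fix e :: real assume "0 < e"
      then obtain j where j: "1 / Suc j < e" using nat_approx_posE by blast
      show "\<forall>\<^sub>F n in sequentially. dist ((\<Sum>k<n. Y k \<omega>) / n) \<mu> < e"
        using *[THEN spec, of j] by eventually_elim (use j in \<open>simp add: dist_real_def\<close>)
    qed
  qed
qed

text \<open>Each variable is clipped at a level: the clipped part obeys the bounded law, the average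
  of the excess is eventually at most about four times its mean, and this mean vanishes by dominated
  convergence as the level grows.\<close>

theorem strong_law_of_large_numbers:
  fixes X :: "nat \<Rightarrow> 'a \<Rightarrow> real"
  assumes ind: "indep_vars (\<lambda>_. borel) X UNIV"
    and ident: "\<And>k. distr M borel (X k) = distr M borel (X 0)"
    and int: "integrable M (X 0)"
  shows "AE \<omega> in M. (\<lambda>n. (\<Sum>k<n. X k \<omega>) / n) \<longlonglongrightarrow> expectation (X 0)"
proof -
  have rv [measurable]: "random_variable borel (X k)" for k
    using ind unfolding indep_vars_def by blast
  define clip where "clip c x = max (- c) (min c x)" for c x :: real
  define R where "R c x = max 0 (\<bar>x\<bar> - c)" for c x :: real
  have [measurable]: "clip c \<in> borel_measurable borel" "R c \<in> borel_measurable borel" for c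
    unfolding clip_def R_def by auto
  have split: "\<bar>x - clip c x\<bar> \<le> R c x" and clip_le: "\<bar>clip c x\<bar> \<le> c"
    and R_nonneg: "0 \<le> R c x" and R_le: "R c x \<le> \<bar>x\<bar>" if "0 < c" for c x
    using that by (auto simp: clip_def R_def)
  define \<delta> where "\<delta> c = expectation (\<lambda>\<omega>. R (real (Suc c)) (X 0 \<omega>))" for c
  have R_int: "integrable M (\<lambda>\<omega>. R (real (Suc c)) (X 0 \<omega>))" for c
    by (rule Bochner_Integration.integrable_bound[OF int]) (use R_nonneg R_le in auto)
  have clip_int: "integrable M (\<lambda>\<omega>. clip (real (Suc c)) (X 0 \<omega>))" for c
    by (rule integrable_const_bound[of _ "real (Suc c)"]) (use clip_le[of "real (Suc c)"] in auto)
  have \<delta>_lim: "\<delta> \<longlonglongrightarrow> 0"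
  proof -
    have "(\<lambda>c. expectation (\<lambda>\<omega>. R (real (Suc c)) (X 0 \<omega>))) \<longlonglongrightarrow> expectation (\<lambda>\<omega>. 0)"
    proof (rule integral_dominated_convergence[where w = "\<lambda>\<omega>. \<bar>X 0 \<omega>\<bar>"])
      show "AE \<omega> in M. (\<lambda>c. R (real (Suc c)) (X 0 \<omega>)) \<longlonglongrightarrow> 0"
      proof (intro AE_I2 tendsto_eventually)
        fix \<omega>
        obtain m :: nat where m: "\<bar>X 0 \<omega>\<bar> < m" using reals_Archimedean2 by blast
        show "\<forall>\<^sub>F c in sequentially. R (real (Suc c)) (X 0 \<omega>) = 0"
          using eventually_ge_at_top[of m] by eventually_elim (use m in \<open>auto simp: R_def\<close>)
      qed
    qed (use int R_nonneg R_le in auto)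
    then show ?thesis by (simp only: \<delta>_def[abs_def] Bochner_Integration.integral_zero)
  qed
  \<comment> \<open>The extra \<open>1 / Suc c\<close> supplies the strict inequality required of
    the bound on the mean, and still tends to zero.\<close>
  define d where "d c = \<delta> c + 1 / Suc c" for c
  have R_law: "AE \<omega> in M. \<forall>\<^sub>F n in sequentially. (\<Sum>k<n. R (real (Suc c)) (X k \<omega>)) \<le> 4 * d c * n" for c
  proof (rule iid_nonneg_sum_eventually_le)
    show "indep_vars (\<lambda>_. borel) (\<lambda>k \<omega>. R (real (Suc c)) (X k \<omega>)) UNIV"
      by (rule indep_vars_compose2[OF ind]) measurable
    show "distr M borel (\<lambda>\<omega>. R (real (Suc c)) (X k \<omega>)) = distr M borel (\<lambda>\<omega>. R (real (Suc c)) (X 0 \<omega>))" for k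
      by (rule distr_compose_identically_distributed[OF ident]) measurable
    show "expectation (\<lambda>\<omega>. R (real (Suc c)) (X 0 \<omega>)) < d c" unfolding d_def \<delta>_def by simp
  qed (use R_nonneg R_int in auto)
  have clip_law: "AE \<omega> in M. (\<lambda>n. (\<Sum>k<n. clip (real (Suc c)) (X k \<omega>)) / n)
      \<longlonglongrightarrow> expectation (\<lambda>\<omega>. clip (real (Suc c)) (X 0 \<omega>))" for c
  proof (rule iid_bounded_strong_law)
    show "indep_vars (\<lambda>_. borel) (\<lambda>k \<omega>. clip (real (Suc c)) (X k \<omega>)) UNIV"
      by (rule indep_vars_compose2[OF ind]) measurable
    show "expectation (\<lambda>\<omega>. clip (real (Suc c)) (X k \<omega>)) = expectation (\<lambda>\<omega>. clip (real (Suc c)) (X 0 \<omega>))" for k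
      by (rule expectation_identically_distributed[OF ident]) measurable
    show "\<bar>clip (real (Suc c)) (X k \<omega>)\<bar> \<le> real (Suc c)" for k \<omega>
      by (rule clip_le) simp
  qed simp
  have mean: "\<bar>expectation (\<lambda>\<omega>. clip (real (Suc c)) (X 0 \<omega>)) - expectation (X 0)\<bar> \<le> \<delta> c" for c
  proof -
    have "\<bar>expectation (\<lambda>\<omega>. clip (real (Suc c)) (X 0 \<omega>)) - expectation (X 0)\<bar>
        = \<bar>expectation (\<lambda>\<omega>. X 0 \<omega> - clip (real (Suc c)) (X 0 \<omega>))\<bar>"
      using int clip_int by (simp add: abs_minus_commute)
    also have "\<dots> \<le> expectation (\<lambda>\<omega>. \<bar>X 0 \<omega> - clip (real (Suc c)) (X 0 \<omega>)\<bar>)"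
      by (rule integral_abs_bound)
    also have "\<dots> \<le> \<delta> c"
      unfolding \<delta>_def using split int clip_int R_int
      by (intro integral_mono) auto
    finally show ?thesis .
  qed
  have "AE \<omega> in M. \<forall>c. (\<forall>\<^sub>F n in sequentially. (\<Sum>k<n. R (real (Suc c)) (X k \<omega>)) \<le> 4 * d c * n) \<and>
      (\<lambda>n. (\<Sum>k<n. clip (real (Suc c)) (X k \<omega>)) / n)
        \<longlonglongrightarrow> expectation (\<lambda>\<omega>. clip (real (Suc c)) (X 0 \<omega>))"
    using R_law clip_law by (simp add: AE_all_countable)
  then show ?thesis
  proof (rule AE_mp, intro AE_I2 impI)
    fix \<omega> assume laws: "\<forall>c. (\<forall>\<^sub>F n in sequentially. (\<Sum>k<n. R (real (Suc c)) (X k \<omega>)) \<le> 4 * d c * n) \<and>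
      (\<lambda>n. (\<Sum>k<n. clip (real (Suc c)) (X k \<omega>)) / n)
        \<longlonglongrightarrow> expectation (\<lambda>\<omega>. clip (real (Suc c)) (X 0 \<omega>))"
    show "(\<lambda>n. (\<Sum>k<n. X k \<omega>) / n) \<longlonglongrightarrow> expectation (X 0)"
      unfolding tendsto_iff
    proof (intro allI impI)
      fix e :: real assume e: "0 < e"
      \<comment> \<open>The level is fixed first: \<open>4 * d c\<close> pays for the excess and
        \<open>\<delta> c\<close> for the shift of the mean by clipping; only then does
        \<open>n\<close> grow.\<close>
      have "(\<lambda>c. 4 * d c + \<delta> c) \<longlonglongrightarrow> 4 * (0 + 0) + 0"
        unfolding d_def using lim_1_over_n[THEN LIMSEQ_Suc]
        by (intro tendsto_intros \<delta>_lim) simp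
      then have "\<forall>\<^sub>F c in sequentially. 4 * d c + \<delta> c < e / 2"
        using e by (intro order_tendstoD) auto
      then obtain c where c: "4 * d c + \<delta> c < e / 2" by (auto simp: eventually_sequentially)
      have "\<forall>\<^sub>F n in sequentially. dist ((\<Sum>k<n. clip (real (Suc c)) (X k \<omega>)) / n)
          (expectation (\<lambda>\<omega>. clip (real (Suc c)) (X 0 \<omega>))) < e / 2"
        using laws e by (intro tendstoD) auto
      moreover have "\<forall>\<^sub>F n in sequentially. (\<Sum>k<n. R (real (Suc c)) (X k \<omega>)) \<le> 4 * d c * n"
        using laws by blast
      ultimately show "\<forall>\<^sub>F n in sequentially. dist ((\<Sum>k<n. X k \<omega>) / n) (expectation (X 0)) < e"
        using eventually_gt_at_top[of 0]
      proof eventually_elim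
        case (elim n)
        have "\<bar>(\<Sum>k<n. X k \<omega>) - (\<Sum>k<n. clip (real (Suc c)) (X k \<omega>))\<bar>
            \<le> (\<Sum>k<n. R (real (Suc c)) (X k \<omega>))"
          unfolding sum_subtractf[symmetric]
          by (rule order_trans[OF sum_abs sum_mono]) (simp add: split)
        then have "\<bar>(\<Sum>k<n. X k \<omega>) - (\<Sum>k<n. clip (real (Suc c)) (X k \<omega>))\<bar> / n \<le> 4 * d c"
          using elim by (simp add: divide_le_eq)
        then have "\<bar>(\<Sum>k<n. X k \<omega>) / n - (\<Sum>k<n. clip (real (Suc c)) (X k \<omega>)) / n\<bar> \<le> 4 * d c"
          by (simp add: diff_divide_distrib[symmetric] abs_divide)
        then show ?case using elim(1) mean[of c] c unfolding dist_real_def by linarith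
      qed
    qed
  qed
qed

end


section \<open>The fluid equation\<close>

definition nbhd_sum :: "('k::finite \<times> 'k) set \<Rightarrow> real ^ 'k \<Rightarrow> 'k \<Rightarrow> real" where
  "nbhd_sum E y i = (\<Sum>j\<in>closed_nbhd E i. y $ j)"

definition fluid_rate :: "('k::finite \<times> 'k) set \<Rightarrow> real ^ 'k \<Rightarrow> 'k \<Rightarrow> real" where
  "fluid_rate E y i =
     y $ i / nbhd_sum E y i * exp (- (\<Sum>j\<in>closed_nbhd E i. y $ j / nbhd_sum E y j))"

text \<open>Conditional probability of a success at \<open>i\<close> in state \<open>w\<close>:
  \<open>of_bool (j = i)\<close> asks for one attempt at \<open>i\<close> and none at its
  neighbours. Vertices outside the neighbourhood have integrated out, see
  \<open>expectation_success\<close>.\<close>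

definition success_prob :: "('k::finite \<times> 'k) set \<Rightarrow> nat ^ 'k \<Rightarrow> 'k \<Rightarrow> real" where
  "success_prob E w i =
     (\<Prod>j\<in>closed_nbhd E i.
        pmf (binomial_pmf (w $ j) (1 / (\<Sum>l\<in>closed_nbhd E j. real (w $ l)))) (of_bool (j = i)))"

lemma self_in_closed_nbhd [simp]: "i \<in> closed_nbhd E i"
  by (simp add: closed_nbhd_def)

lemma closed_nbhd_not_empty [simp]: "closed_nbhd E i \<noteq> {}"
  by (simp add: closed_nbhd_def)

lemma closed_nbhd_sym: "sym E \<Longrightarrow> j \<in> closed_nbhd E i \<longleftrightarrow> i \<in> closed_nbhd E j"
  by (auto simp: closed_nbhd_def dest: symD)

lemma nbhd_sum_pos: "(\<And>i. 0 < y $ i) \<Longrightarrow> 0 < nbhd_sum E y i"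
  unfolding nbhd_sum_def by (intro sum_pos) auto

lemma success_prob_nonneg: "0 \<le> success_prob E w i"
  unfolding success_prob_def by (intro prod_nonneg) simp

lemma success_prob_le_1: "success_prob E w i \<le> 1"
  unfolding success_prob_def by (intro prod_le_1) (simp add: pmf_le_1)

text \<open>Tangent-line estimates \<open>exp x \<ge> 1 + x\<close> at the symmetric point, where
  \<open>\<phi>\<^sub>i = 1 / V\<close> and \<open>\<Sum>\<^bsub>j\<in>V\<^sub>i\<^esub> \<phi>\<^sub>j = 1\<close>, reduce the bound to the double counting identities
  \<open>\<Sum>\<^sub>i \<Sum>\<^bsub>j\<in>V\<^sub>i\<^esub> z\<^sub>j = V \<Sum>\<^sub>i z\<^sub>i\<close> and \<open>\<Sum>\<^sub>i z\<^sub>i \<Sum>\<^bsub>j\<in>V\<^sub>i\<^esub> \<phi>\<^sub>j = \<Sum>\<^sub>i z\<^sub>i\<close>.\<close>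

lemma fluid_rate_lyapunov_bound:
  fixes y :: "real ^ 'k::finite"
  assumes sym: "sym E" and card: "\<And>i. card (closed_nbhd E i) = V" and pos: "\<And>i. 0 < y $ i"
  shows "exp (- 1) / V * (\<Sum>i\<in>UNIV. y $ i) \<le> (\<Sum>i\<in>UNIV. y $ i * fluid_rate E y i)"
proof -
  define S where "S = nbhd_sum E y"
  have S_pos: "0 < S i" for i unfolding S_def using nbhd_sum_pos[OF pos] .
  have V: "0 < V" using card[of undefined] by (metis card_gt_0_iff closed_nbhd_not_empty finite)
  have "{i. j \<in> closed_nbhd E i} = closed_nbhd E j" for j
    using closed_nbhd_sym[OF sym] by blast
  then have swap: "(\<Sum>i\<in>UNIV. \<Sum>j\<in>closed_nbhd E i. f i j) = (\<Sum>j\<in>UNIV. \<Sum>i\<in>closed_nbhd E j. f i j)"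
    for f :: "'k \<Rightarrow> 'k \<Rightarrow> real"
    using sum.swap_restrict[of UNIV UNIV f "\<lambda>i j. j \<in> closed_nbhd E i"] by simp
  have sum_S: "(\<Sum>i\<in>UNIV. S i) = V * (\<Sum>i\<in>UNIV. y $ i)"
    unfolding S_def nbhd_sum_def using swap[of "\<lambda>i j. y $ j"] by (simp add: card sum_distrib_left)
  define \<psi> where "\<psi> i = (\<Sum>j\<in>closed_nbhd E i. y $ j / S j)" for i
  have sum_\<psi>: "(\<Sum>i\<in>UNIV. y $ i * \<psi> i) = (\<Sum>i\<in>UNIV. y $ i)"
  proof -
    have "(\<Sum>i\<in>UNIV. y $ i * \<psi> i) = (\<Sum>j\<in>UNIV. \<Sum>i\<in>closed_nbhd E j. y $ i * (y $ j / S j))"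
      unfolding \<psi>_def sum_distrib_left by (rule swap)
    also have "\<dots> = (\<Sum>j\<in>UNIV. S j * (y $ j / S j))"
      by (simp only: sum_distrib_right[symmetric]) (simp add: S_def nbhd_sum_def)
    also have "\<dots> = (\<Sum>i\<in>UNIV. y $ i)"
      using S_pos by (intro sum.cong) (auto simp: less_imp_neq[THEN not_sym])
    finally show ?thesis .
  qed
  \<comment> \<open>The value of \<open>fluid_rate\<close> at a constant positive vector; its
    logarithm \<open>- 1 - ln V\<close> is the point at which \<open>exp\<close> is
    linearised.\<close>
  define c where "c = exp (- 1) / V"
  have c: "c = exp (- 1 - ln V)" using V by (simp add: c_def exp_diff)
  have key: "c * (y $ i + (2 * y $ i - y $ i * \<psi> i - S i / V)) \<le> y $ i * fluid_rate E y i" for i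
  proof -
    let ?u = "ln (y $ i / S i) - \<psi> i"
    have rate: "fluid_rate E y i = exp ?u"
      using pos[of i] S_pos[of i]
      by (simp add: fluid_rate_def S_def[symmetric] \<psi>_def exp_diff exp_minus divide_inverse)
    \<comment> \<open>A second linearisation, of \<open>ln\<close> at 1. After multiplication by
      \<open>y $ i\<close> its error term is linear in \<open>S i\<close>, so double counting can
      sum it.\<close>
    have "ln (S i / (V * y $ i)) \<le> S i / (V * y $ i) - 1"
      using pos[of i] S_pos[of i] V by (intro ln_le_minus_one) simp
    then have "ln (y $ i / S i) \<ge> 1 - ln V - S i / (V * y $ i)"
      using pos[of i] S_pos[of i] V by (simp add: ln_div ln_mult)
    then have "3 - \<psi> i - S i / (V * y $ i) \<le> 1 + (?u - (- 1 - ln V))" by simp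
    also have "\<dots> \<le> exp (?u - (- 1 - ln V))" by (rule exp_ge_add_one_self)
    finally have "y $ i * (c * (3 - \<psi> i - S i / (V * y $ i)))
        \<le> y $ i * (c * exp (?u - (- 1 - ln V)))"
      using pos[of i] V by (intro mult_left_mono) (auto simp: c_def)
    also have "c * exp (?u - (- 1 - ln V)) = exp ?u"
      unfolding c exp_add[symmetric] by simp
    finally have "y $ i * (c * (3 - \<psi> i - S i / (V * y $ i))) \<le> y $ i * fluid_rate E y i"
      unfolding rate .
    moreover have "y $ i \<noteq> 0" using pos[of i] by simp
    ultimately show ?thesis by (simp add: algebra_simps)
  qed
  \<comment> \<open>The inner bracket sums to zero: it contributes 2 - 1 - 1 times the total of
    \<open>y\<close>, by \<open>sum_\<psi>\<close> and \<open>sum_S\<close>.\<close>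
  have "(\<Sum>i\<in>UNIV. c * (y $ i + (2 * y $ i - y $ i * \<psi> i - S i / V)))
      = c * (\<Sum>i\<in>UNIV. y $ i)"
    unfolding sum_distrib_left[symmetric]
    using V by (simp add: sum.distrib sum_subtractf sum_negf sum_\<psi> sum_S
        sum_divide_distrib[symmetric] sum_distrib_left[symmetric])
  moreover have "(\<Sum>i\<in>UNIV. c * (y $ i + (2 * y $ i - y $ i * \<psi> i - S i / V)))
      \<le> (\<Sum>i\<in>UNIV. y $ i * fluid_rate E y i)"
    by (intro sum_mono key)
  ultimately show ?thesis by (simp add: c_def)
qed

text \<open>The mass at 0 is \<open>exp\<close> of the convergent ratio times
  \<open>S * ln (1 - 1 / S)\<close>, which tends to -1. The mass at 1 is written with a division by
  \<open>1 - 1 / S\<close> rather than the exponent \<open>w - 1\<close>, so the first limit can be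
  reused.\<close>

lemma binomial_pmf_tendsto_poisson:
  fixes w :: "'a \<Rightarrow> nat" and S :: "'a \<Rightarrow> real"
  assumes S: "filterlim S at_top F" and ratio: "((\<lambda>a. w a / S a) \<longlongrightarrow> \<phi>) F"
  shows "((\<lambda>a. pmf (binomial_pmf (w a) (1 / S a)) 0) \<longlongrightarrow> exp (- \<phi>)) F"
    and "((\<lambda>a. pmf (binomial_pmf (w a) (1 / S a)) 1) \<longlongrightarrow> \<phi> * exp (- \<phi>)) F"
proof -
  have S_gt: "\<forall>\<^sub>F a in F. 1 < S a" using S filterlim_at_top_dense by blast
  have "((\<lambda>s::real. s * ln (1 - 1 / s)) \<longlongrightarrow> - 1) at_top"
    by real_asymp
  then have "((\<lambda>a. S a * ln (1 - 1 / S a)) \<longlongrightarrow> - 1) F"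
    by (rule filterlim_compose[OF _ S])
  then have "((\<lambda>a. exp (w a / S a * (S a * ln (1 - 1 / S a)))) \<longlongrightarrow> exp (\<phi> * - 1)) F"
    by (intro tendsto_intros ratio)
  moreover have "\<forall>\<^sub>F a in F. exp (w a / S a * (S a * ln (1 - 1 / S a))) = (1 - 1 / S a) ^ w a"
    using S_gt
  proof eventually_elim
    case (elim a)
    have "w a / S a * (S a * ln (1 - 1 / S a)) = w a * ln (1 - 1 / S a)" using elim by simp
    then show ?case using elim by (simp add: exp_of_nat_mult)
  qed
  ultimately have pow: "((\<lambda>a. (1 - 1 / S a) ^ w a) \<longlongrightarrow> exp (- \<phi>)) F"
    by (simp add: filterlim_cong[OF refl refl])
  have "\<forall>\<^sub>F a in F. pmf (binomial_pmf (w a) (1 / S a)) 0 = (1 - 1 / S a) ^ w a"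
    using S_gt by eventually_elim (simp add: pmf_binomial)
  with pow show "((\<lambda>a. pmf (binomial_pmf (w a) (1 / S a)) 0) \<longlongrightarrow> exp (- \<phi>)) F"
    by (simp add: filterlim_cong[OF refl refl])
  have "((\<lambda>a. w a / S a * ((1 - 1 / S a) ^ w a / (1 - 1 / S a))) \<longlongrightarrow> \<phi> * (exp (- \<phi>) / (1 - 0))) F"
    by (intro tendsto_intros ratio pow tendsto_divide_0[OF tendsto_const] filterlim_at_top_imp_at_infinity S)
      auto
  moreover have "\<forall>\<^sub>F a in F. pmf (binomial_pmf (w a) (1 / S a)) 1
      = w a / S a * ((1 - 1 / S a) ^ w a / (1 - 1 / S a))"
    using S_gt
  proof eventually_elim
    case (elim a)
    then show ?case by (cases "w a") (auto simp: pmf_binomial)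
  qed
  ultimately show "((\<lambda>a. pmf (binomial_pmf (w a) (1 / S a)) 1) \<longlongrightarrow> \<phi> * exp (- \<phi>)) F"
    by (simp add: filterlim_cong[OF refl refl])
qed

text \<open>Positivity of \<open>y\<close> makes every neighbourhood load grow in proportion to
  \<open>m\<close>, which puts each factor of the product in the Poisson regime.\<close>

lemma success_prob_tendsto:
  fixes w :: "'a \<Rightarrow> nat ^ 'k::finite"
  assumes m: "filterlim m at_top F" and w: "((\<lambda>a. (1 / m a) *\<^sub>R real_vec (w a)) \<longlongrightarrow> y) F"
    and pos: "\<And>i. 0 < y $ i"
  shows "((\<lambda>a. success_prob E (w a) i) \<longlongrightarrow> fluid_rate E y i) F"
proof -
  define S where "S a j = (\<Sum>l\<in>closed_nbhd E j. real (w a $ l))" for a j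
  have m_pos: "\<forall>\<^sub>F a in F. 0 < m a" using m filterlim_at_top_dense by blast
  have comp: "((\<lambda>a. w a $ j / m a) \<longlongrightarrow> y $ j) F" for j
    using tendsto_vec_nth[OF w, of j] by (simp add: real_vec_def)
  have load: "((\<lambda>a. S a j / m a) \<longlongrightarrow> nbhd_sum E y j) F" for j
    unfolding S_def nbhd_sum_def sum_divide_distrib by (intro tendsto_sum comp)
  have S_top: "filterlim (\<lambda>a. S a j) at_top F" for j
  proof -
    have "filterlim (\<lambda>a. S a j / m a * m a) at_top F"
      by (rule filterlim_tendsto_pos_mult_at_top[OF load nbhd_sum_pos[OF pos] m])
    then show ?thesis
      by (rule filterlim_cong[OF refl refl, THEN iffD1, rotated])
        (use m_pos in \<open>eventually_elim, simp\<close>)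
  qed
  have ratio: "((\<lambda>a. w a $ j / S a j) \<longlongrightarrow> y $ j / nbhd_sum E y j) F" for j
  proof -
    have "((\<lambda>a. (w a $ j / m a) / (S a j / m a)) \<longlongrightarrow> y $ j / nbhd_sum E y j) F"
      using nbhd_sum_pos[OF pos, of E j] by (intro tendsto_divide comp load) simp
    then show ?thesis
      by (rule filterlim_cong[OF refl refl, THEN iffD1, rotated])
        (use m_pos in \<open>eventually_elim, simp\<close>)
  qed
  define \<phi> where "\<phi> j = y $ j / nbhd_sum E y j" for j
  have "((\<lambda>a. success_prob E (w a) i)
      \<longlongrightarrow> (\<Prod>j\<in>closed_nbhd E i. (if j = i then \<phi> i else 1) * exp (- \<phi> j))) F"
    unfolding success_prob_def S_def[symmetric]
  proof (intro tendsto_prod)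
    fix j
    show "((\<lambda>a. pmf (binomial_pmf (w a $ j) (1 / S a j)) (of_bool (j = i)))
        \<longlongrightarrow> (if j = i then \<phi> i else 1) * exp (- \<phi> j)) F"
      using binomial_pmf_tendsto_poisson[OF S_top ratio, of j] by (cases "j = i") (auto simp: \<phi>_def)
  qed
  also have "(\<Prod>j\<in>closed_nbhd E i. (if j = i then \<phi> i else 1) * exp (- \<phi> j)) = fluid_rate E y i"
    by (simp add: prod.distrib exp_sum[symmetric] sum_negf prod.delta' \<phi>_def fluid_rate_def)
  finally show ?thesis .
qed

text \<open>Uniformity over all states near \<open>y\<close> comes from taking the limit along the
  filter on pairs \<open>(m, w)\<close> generated by \<open>m\<close> tending to infinity and
  \<open>w / m\<close> tending to \<open>y\<close>.\<close>

lemma success_prob_near_fluid_rate: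
  fixes y :: "real ^ 'k::finite"
  assumes pos: "\<And>i. 0 < y $ i" and e: "0 < e"
  shows "\<exists>\<delta>>0. \<forall>\<^sub>F m in at_top. \<forall>w :: nat ^ 'k. (\<forall>j. \<bar>w $ j / m - y $ j\<bar> < \<delta>) \<longrightarrow>
      \<bar>success_prob E w i - fluid_rate E y i\<bar> < e"
proof -
  define F where "F = inf (filtercomap fst at_top)
    (filtercomap (\<lambda>(m, w). (1 / m) *\<^sub>R real_vec w) (nhds y))"
  have "filterlim fst at_top F"
    unfolding F_def by (rule filterlim_mono[OF filterlim_filtercomap order_refl inf_le1])
  moreover have "((\<lambda>a. (1 / fst a) *\<^sub>R real_vec (snd a)) \<longlongrightarrow> y) F"
  proof -
    have "filterlim (\<lambda>(m, w). (1 / m) *\<^sub>R real_vec w) (nhds y) F"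
      unfolding F_def by (rule filterlim_mono[OF filterlim_filtercomap order_refl inf_le2])
    then show ?thesis by (simp add: case_prod_unfold)
  qed
  ultimately have "((\<lambda>a. success_prob E (snd a) i) \<longlongrightarrow> fluid_rate E y i) F"
    by (rule success_prob_tendsto) (rule pos)
  then have "\<forall>\<^sub>F a in F. dist (success_prob E (snd a) i) (fluid_rate E y i) < e"
    using e by (rule tendstoD)
  then obtain P Q where P: "eventually P (filtercomap fst (at_top :: real filter))"
    and Q: "eventually Q (filtercomap (\<lambda>(m, w). (1 / m) *\<^sub>R real_vec w) (nhds y))"
    and PQ: "\<And>a. P a \<Longrightarrow> Q a \<Longrightarrow> dist (success_prob E (snd a) i) (fluid_rate E y i) < e"
    unfolding F_def eventually_inf by blast
  obtain P' where P': "eventually P' at_top" "\<And>a. P' (fst a) \<Longrightarrow> P a"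
    using P unfolding eventually_filtercomap by blast
  obtain d where d: "0 < d" "\<And>m w. dist ((1 / m) *\<^sub>R real_vec w) y < d \<Longrightarrow> Q (m, w)"
    using Q unfolding eventually_filtercomap eventually_nhds_metric by fastforce
  show ?thesis
  proof (intro exI conjI)
    \<comment> \<open>The Euclidean norm is bounded by the sum of the \<open>CARD('k)\<close>
      coordinates.\<close>
    show "0 < d / CARD('k)" using d(1) by simp
    show "\<forall>\<^sub>F m in at_top. \<forall>w :: nat ^ 'k. (\<forall>j. \<bar>w $ j / m - y $ j\<bar> < d / CARD('k)) \<longrightarrow>
        \<bar>success_prob E w i - fluid_rate E y i\<bar> < e"
      using P'(1)
    proof eventually_elim
      case (elim m)
      show ?case
      proof (intro allI impI)
        fix w :: "nat ^ 'k" assume w: "\<forall>j. \<bar>w $ j / m - y $ j\<bar> < d / CARD('k)"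
        have "dist ((1 / m) *\<^sub>R real_vec w) y \<le> (\<Sum>j\<in>UNIV. \<bar>((1 / m) *\<^sub>R real_vec w - y) $ j\<bar>)"
          unfolding dist_norm by (rule norm_le_l1_cart)
        also have "\<dots> < (\<Sum>j\<in>(UNIV :: 'k set). d / CARD('k))"
          using w by (intro sum_strict_mono) (auto simp: real_vec_def)
        finally have "dist ((1 / m) *\<^sub>R real_vec w) y < d" by simp
        then show "\<bar>success_prob E w i - fluid_rate E y i\<bar> < e"
          using PQ[of "(m, w)"] P'(2)[of "(m, w)"] elim d(2) by (simp add: dist_real_def)
      qed
    qed
  qed
qed

text \<open>The almost sure properties of one sample point from which the fluid equation follows.
  \<open>success_average\<close> is uniform over all initial states of norm \<open>m\<close>, so it
  applies to sequences of initial states chosen after the realisation.\<close>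

locale fluid_realisation =
  fixes E :: "('k::finite \<times> 'k) set"
    and rate :: "'k \<Rightarrow> real"
    and a :: "nat \<Rightarrow> nat ^ 'k"
    and v :: "nat ^ 'k \<Rightarrow> nat \<Rightarrow> nat ^ 'k"
  assumes arrivals_average: "\<And>i. (\<lambda>n. (\<Sum>k<n. real (a (Suc k) $ i)) / n) \<longlonglongrightarrow> rate i"
    and success_le_queue: "\<And>x n i. success E (v x n) i \<le> queue E a (v x) x n $ i"
    and success_average: "\<And>i e T. 0 < e \<Longrightarrow>
      \<forall>\<^sub>F m in at_top. \<forall>x. l1_norm (real_vec x) = m \<longrightarrow> (\<forall>n. real n \<le> T * m \<longrightarrow>
        \<bar>\<Sum>k<n. real (success E (v x k) i) - success_prob E (queue E a (v x) x k) i\<bar> \<le> e * m)"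
begin

section \<open>Fluid limits along a good realisation\<close>

abbreviation W :: "nat ^ 'k \<Rightarrow> nat \<Rightarrow> nat ^ 'k" where
  "W x \<equiv> queue E a (v x) x"

text \<open>By \<open>success_le_queue\<close> the truncated subtraction in \<open>queue\<close> is
  a true one.\<close>

lemma queue_eq_sum:
  "real (W x n $ i) = x $ i + (\<Sum>k<n. real (a (Suc k) $ i)) - (\<Sum>k<n. real (success E (v x k) i))"
proof (induction n)
  case (Suc n)
  then show ?case
    using success_le_queue[of x n i] by (simp add: of_nat_diff trans_le_add1)
qed simp

text \<open>Beyond some \<open>n0\<close> the error is a small multiple of \<open>n\<close>, hence
  of \<open>m\<close>; the finitely many earlier times contribute a constant that large
  \<open>m\<close> absorbs.\<close>

lemma arrivals_average_uniform:
  assumes e: "0 < e"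
  shows "\<forall>\<^sub>F m in at_top. \<forall>n. real n \<le> T * m \<longrightarrow>
    \<bar>(\<Sum>k<n. real (a (Suc k) $ i)) - rate i * n\<bar> \<le> e * m"
proof -
  define d where "d n = \<bar>(\<Sum>k<n. real (a (Suc k) $ i)) - rate i * n\<bar>" for n
  define e' where "e' = e / (\<bar>T\<bar> + 1)"
  have e': "0 < e'" "e' * \<bar>T\<bar> \<le> e" using e by (auto simp: e'_def field_simps)
  obtain n0 where n0: "\<And>n. n0 \<le> n \<Longrightarrow> \<bar>(\<Sum>k<n. real (a (Suc k) $ i)) / n - rate i\<bar> < e'"
    using tendstoD[OF arrivals_average e'(1), of i]
    by (auto simp: eventually_sequentially dist_real_def)
  have large: "d n \<le> e' * n" if "n0 \<le> n" for n
  proof (cases "n = 0")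
    case False
    then have "d n = \<bar>(\<Sum>k<n. real (a (Suc k) $ i)) / n - rate i\<bar> * n"
      unfolding d_def by (simp add: abs_mult_pos field_simps)
    then show ?thesis using n0[OF that] by (simp add: mult_right_mono)
  qed (simp add: d_def)
  have small: "d n \<le> (\<Sum>n<n0. d n)" if "n < n0" for n
    using that by (intro member_le_sum) (auto simp: d_def)
  show ?thesis
    using eventually_ge_at_top[of "(\<Sum>n<n0. d n) / e"] eventually_ge_at_top[of 0]
  proof eventually_elim
    case (elim m)
    show ?case
      unfolding d_def[symmetric]
    proof (intro allI impI)
      fix n assume n: "real n \<le> T * m"
      show "d n \<le> e * m"
      proof (cases "n0 \<le> n")
        case True
        have "e' * n \<le> e' * (\<bar>T\<bar> * m)"
          using n elim(2) e'(1)
          by (intro mult_left_mono order_trans[OF n] mult_right_mono) auto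
        also have "\<dots> \<le> e * m"
          using e'(2) elim(2) by (simp add: mult.assoc[symmetric] mult_right_mono)
        finally show ?thesis using large[OF True] by simp
      next
        case False
        then show ?thesis using small[of n] elim(1) e by (simp add: divide_le_eq mult.commute)
      qed
    qed
  qed
qed

lemma queue_increment:
  assumes e: "0 < e"
  shows "\<forall>\<^sub>F m in at_top. \<forall>x. l1_norm (real_vec x) = m \<longrightarrow>
    (\<forall>n n'. n \<le> n' \<longrightarrow> real n' \<le> T * m \<longrightarrow>
      \<bar>real (W x n' $ i) - W x n $ i - rate i * (real n' - real n)
        + (\<Sum>k=n..<n'. success_prob E (W x k) i)\<bar> \<le> e * m)"
proof -
  \<comment> \<open>Four errors add up: arrivals and successes, each at both endpoints.\<close>
  have e4: "0 < e / 4" using e by simp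
  show ?thesis
    using arrivals_average_uniform[OF e4, of T i] success_average[OF e4, of T i]
  proof eventually_elim
    case (elim m)
    show ?case
    proof (intro allI impI)
      fix x :: "nat ^ 'k" and n n' :: nat
      assume x: "l1_norm (real_vec x) = m" and n: "n \<le> n'" and n': "real n' \<le> T * m"
      then have nT: "real n \<le> T * m" by simp
      let ?A = "\<lambda>n. \<Sum>k<n. real (a (Suc k) $ i)" and ?S = "\<lambda>n. \<Sum>k<n. real (success E (v x k) i)"
      let ?P = "\<lambda>n. \<Sum>k<n. success_prob E (W x k) i"
      have "\<bar>?A n' - rate i * n'\<bar> \<le> e / 4 * m" "\<bar>?A n - rate i * n\<bar> \<le> e / 4 * m"
        "\<bar>?S n' - ?P n'\<bar> \<le> e / 4 * m" "\<bar>?S n - ?P n\<bar> \<le> e / 4 * m"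
        using elim x n' nT by (auto simp: sum_subtractf)
      moreover have "(\<Sum>k=n..<n'. success_prob E (W x k) i) = ?P n' - ?P n"
        using n by (simp add: sum_diff_nat_ivl lessThan_atLeast0)
      ultimately show "\<bar>real (W x n' $ i) - W x n $ i - rate i * (real n' - real n)
          + (\<Sum>k=n..<n'. success_prob E (W x k) i)\<bar> \<le> e * m"
        unfolding queue_eq_sum right_diff_distrib by linarith
    qed
  qed
qed

text \<open>A frequent event meets an eventual one, so a single initial state serves for each
  tolerance and no convergent subsequence is extracted. \<open>P\<close> collects whatever is
  demanded of a large norm.\<close>

lemma fluid_limit_approx:
  assumes z: "fluid_limit E a v z" and e: "0 < e" and P: "eventually P at_top"
  obtains x where "P (l1_norm (real_vec x))"
    "fluid_scaling (l1_norm (real_vec x)) (W x) \<in> skorokhod_nbhd T e z"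
proof -
  obtain x where x: "filterlim (\<lambda>n. l1_norm (real_vec (x n))) at_top sequentially"
    and acc: "\<And>U. openin skorokhod_topology U \<Longrightarrow> z \<in> U \<Longrightarrow>
      \<exists>\<^sub>F n in sequentially. fluid_scaling (l1_norm (real_vec (x n))) (W (x n)) \<in> U"
    using z unfolding fluid_limit_def by blast
  obtain U where U: "openin skorokhod_topology U" "z \<in> U" "U \<subseteq> skorokhod_nbhd T e z"
    using skorokhod_nbhd_open[OF e] by blast
  have near: "\<exists>\<^sub>F n in sequentially.
      fluid_scaling (l1_norm (real_vec (x n))) (W (x n)) \<in> skorokhod_nbhd T e z"
    by (rule frequently_elim1[OF acc[OF U(1,2)]]) (use U(3) in blast)
  have "\<forall>\<^sub>F n in sequentially. P (l1_norm (real_vec (x n)))"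
    using x P by (simp add: filterlim_iff)
  then have "\<exists>\<^sub>F n in sequentially. P (l1_norm (real_vec (x n))) \<and>
      fluid_scaling (l1_norm (real_vec (x n))) (W (x n)) \<in> skorokhod_nbhd T e z"
    by (intro frequently_rev_mp[OF near]) (auto elim: eventually_mono)
  then show thesis using that by (auto dest: frequently_ex)
qed

text \<open>Success probabilities lie in [0, 1], so the queue moves at speed at most
  \<open>\<bar>rate i\<bar> + 1\<close> on the fluid scale; time change, rounding and approximation
  only cost terms that vanish.\<close>

lemma fluid_limit_lipschitz:
  assumes z: "fluid_limit E a v z" and st: "0 \<le> s" "s \<le> t"
  shows "\<bar>z t $ i - z s $ i\<bar> \<le> (\<bar>rate i\<bar> + 1) * (t - s)"
proof (rule field_le_epsilon)
  fix e0 :: real assume e0: "0 < e0"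
  define L where "L = \<bar>rate i\<bar> + 1"
  \<comment> \<open>The time change costs \<open>2 * L * e\<close>; the four remaining
    \<open>e\<close> are the increment estimate, the rounding \<open>L / m\<close>, and the distance
    to \<open>z\<close> at the two endpoints.\<close>
  define e where "e = min 1 (e0 / (4 + 2 * L))"
  have L: "1 \<le> L" by (simp add: L_def)
  have e: "0 < e" "e \<le> 1" using e0 L by (auto simp: e_def)
  have eL: "e * (4 + 2 * L) \<le> e0"
    using mult_right_mono[of e "e0 / (4 + 2 * L)" "4 + 2 * L"] L by (simp add: e_def)
  \<comment> \<open>The horizon \<open>t + 2\<close> leaves one unit for the time change and one for
    the ceiling.\<close>
  define Q where "Q m \<longleftrightarrow> 1 \<le> m \<and> L / e \<le> m \<and> (\<forall>x. l1_norm (real_vec x) = m \<longrightarrow>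
    (\<forall>n n'. n \<le> n' \<longrightarrow> real n' \<le> (t + 2) * m \<longrightarrow>
      \<bar>real (W x n' $ i) - W x n $ i - rate i * (real n' - real n)
        + (\<Sum>k=n..<n'. success_prob E (W x k) i)\<bar> \<le> e * m))" for m
  have "eventually Q at_top"
    unfolding Q_def by (intro eventually_conj eventually_ge_at_top queue_increment e)
  then obtain x where Q: "Q (l1_norm (real_vec x))"
    and near: "fluid_scaling (l1_norm (real_vec x)) (W x) \<in> skorokhod_nbhd t e z"
    by (rule fluid_limit_approx[OF z e(1)])
  define m where "m = l1_norm (real_vec x)"
  have x: "1 \<le> m" "L / e \<le> m"
    and incr: "\<And>n n'. n \<le> n' \<Longrightarrow> real n' \<le> (t + 2) * m \<Longrightarrow>
      \<bar>real (W x n' $ i) - W x n $ i - rate i * (real n' - real n)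
        + (\<Sum>k=n..<n'. success_prob E (W x k) i)\<bar> \<le> e * m"
    using Q unfolding Q_def m_def by auto
  obtain \<mu> where \<mu>: "strict_mono_on {0..} \<mu>" "\<mu> ` {0..} = {0..}" "\<And>s. 0 \<le> s \<Longrightarrow> \<bar>\<mu> s - s\<bar> < e"
    and close: "\<And>s. s \<in> {0..t} \<Longrightarrow> dist (fluid_scaling m (W x) (\<mu> s)) (z s) < e"
    using near unfolding skorokhod_nbhd_def time_change_def m_def by auto
  have \<mu>0: "0 \<le> \<mu> s" using \<mu>(2) st by (metis atLeast_iff imageI)
  have \<mu>_le: "\<mu> s \<le> \<mu> t" using \<mu>(1) st by (metis atLeast_iff order.order_iff_strict order_trans strict_mono_onD)
  define n n' where "n = nat \<lceil>m * \<mu> s\<rceil>" and "n' = nat \<lceil>m * \<mu> t\<rceil>"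
  have nonneg: "0 \<le> m * \<mu> s" using x(1) \<mu>0 by simp
  have le: "m * \<mu> s \<le> m * \<mu> t" using x(1) \<mu>_le by simp
  have n: "n \<le> n'" unfolding n_def n'_def by (intro nat_mono ceiling_mono le)
  have bounds: "real n \<ge> m * \<mu> s" "real n' \<le> m * \<mu> t + 1"
    using nonneg le unfolding n_def n'_def by linarith+
  have "m * \<mu> t \<le> m * (t + 1)"
    using \<mu>(3)[of t] st e(2) x(1) by (intro mult_left_mono) auto
  then have n'_le: "real n' \<le> (t + 2) * m" using x(1) bounds(2) by (simp add: algebra_simps)
  have P: "0 \<le> (\<Sum>k=n..<n'. success_prob E (W x k) i)"
      "(\<Sum>k=n..<n'. success_prob E (W x k) i) \<le> real n' - real n"
    using n sum_mono[of "{n..<n'}" "\<lambda>k. success_prob E (W x k) i" "\<lambda>_. 1"]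
    by (auto intro!: sum_nonneg success_prob_nonneg success_prob_le_1)
  have "\<bar>real (W x n' $ i) - W x n $ i\<bar> \<le> L * (real n' - real n) + e * m"
  proof -
    have "\<bar>rate i * (real n' - real n)\<bar> = \<bar>rate i\<bar> * (real n' - real n)" using n by (simp add: abs_mult)
    then show ?thesis using incr[OF n n'_le] P unfolding L_def by (simp add: distrib_right)
  qed
  also have "\<dots> \<le> L * (m * (\<mu> t - \<mu> s) + 1) + e * m"
    using bounds L by (intro add_right_mono mult_left_mono) (auto simp: algebra_simps)
  finally have "\<bar>real (W x n' $ i) - W x n $ i\<bar> / m \<le> (L * (m * (\<mu> t - \<mu> s) + 1) + e * m) / m"
    using x(1) by (intro divide_right_mono) auto
  also have "\<dots> = L * (\<mu> t - \<mu> s) + L / m + e" using x(1) by (simp add: field_simps)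
  also have "L / m \<le> e" using x e by (simp add: field_simps)
  also have "L * (\<mu> t - \<mu> s) \<le> L * (t - s + 2 * e)"
    using \<mu>(3)[of s] \<mu>(3)[of t] st L by (intro mult_left_mono) auto
  finally have X: "\<bar>fluid_scaling m (W x) (\<mu> t) $ i - fluid_scaling m (W x) (\<mu> s) $ i\<bar>
      \<le> L * (t - s + 2 * e) + 2 * e"
    using x(1) by (simp add: fluid_scaling_def real_vec_def n_def n'_def diff_divide_distrib[symmetric])
  have c: "\<bar>fluid_scaling m (W x) (\<mu> u) $ i - z u $ i\<bar> < e" if "u \<in> {0..t}" for u
    using component_le_norm_cart[of "fluid_scaling m (W x) (\<mu> u) - z u" i] close[OF that]
    by (simp add: dist_norm)
  have "\<bar>z t $ i - z s $ i\<bar> \<le> L * (t - s + 2 * e) + 2 * e + 2 * e"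
    using X c[of s] c[of t] st by auto
  also have "\<dots> = L * (t - s) + e * (4 + 2 * L)" by (simp add: algebra_simps)
  finally show "\<bar>z t $ i - z s $ i\<bar> \<le> (\<bar>rate i\<bar> + 1) * (t - s) + e0"
    using eL unfolding L_def by linarith
qed

lemma fluid_limit_lipschitz_abs:
  assumes z: "fluid_limit E a v z" and st: "0 \<le> s" "0 \<le> t"
  shows "\<bar>z t $ i - z s $ i\<bar> \<le> (\<bar>rate i\<bar> + 1) * \<bar>t - s\<bar>"
proof (cases "s \<le> t")
  case True
  then show ?thesis using fluid_limit_lipschitz[OF z st(1) True, of i] by simp
next
  case False
  then have "\<bar>z s $ i - z t $ i\<bar> \<le> (\<bar>rate i\<bar> + 1) * \<bar>t - s\<bar>"
    using fluid_limit_lipschitz[OF z st(2), of s i] by simp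
  then show ?thesis by (simp only: abs_minus_commute[of "z t $ i"])
qed

text \<open>The time change moves the argument of the Lipschitz path \<open>z\<close> by less than
  \<open>d\<close>, hence its value by at most \<open>L * d\<close>. The neighbourhood is taken up
  to \<open>T + 1\<close> because the preimage of a time below \<open>T\<close> may lie beyond
  \<open>T\<close>.\<close>

lemma fluid_limit_approx_uniform:
  assumes z: "fluid_limit E a v z" and e: "0 < e" and P: "eventually P at_top"
  shows "\<exists>x. P (l1_norm (real_vec x)) \<and> (\<forall>t i. 0 \<le> t \<longrightarrow> t \<le> T \<longrightarrow>
    \<bar>fluid_scaling (l1_norm (real_vec x)) (W x) t $ i - z t $ i\<bar> \<le> e)"
proof -
  define L where "L = (\<Sum>i\<in>UNIV. \<bar>rate i\<bar> + 1)"
  have L_le: "\<bar>rate i\<bar> + 1 \<le> L" for i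
    unfolding L_def by (intro member_le_sum) auto
  have L: "0 < L" using L_le[of undefined] by linarith
  define d where "d = min 1 (e / (1 + L))"
  have d: "0 < d" "d \<le> 1" using e L by (auto simp: d_def)
  have dL: "d * (1 + L) \<le> e"
    using mult_right_mono[of d "e / (1 + L)" "1 + L"] L by (simp add: d_def)
  obtain x where x: "P (l1_norm (real_vec x))"
    and near: "fluid_scaling (l1_norm (real_vec x)) (W x) \<in> skorokhod_nbhd (T + 1) d z"
    using fluid_limit_approx[OF z d(1) P] by blast
  define m where "m = l1_norm (real_vec x)"
  obtain \<mu> where \<mu>: "\<mu> ` {0..} = {0..}" "\<And>s. 0 \<le> s \<Longrightarrow> \<bar>\<mu> s - s\<bar> < d"
    and close: "\<And>s. s \<in> {0..T + 1} \<Longrightarrow> dist (fluid_scaling m (W x) (\<mu> s)) (z s) < d"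
    using near unfolding skorokhod_nbhd_def time_change_def m_def by auto
  have "\<bar>fluid_scaling m (W x) t $ i - z t $ i\<bar> \<le> e" if t: "0 \<le> t" "t \<le> T" for t i
  proof -
    obtain s where s: "0 \<le> s" "t = \<mu> s" using \<mu>(1) t(1) by (metis atLeast_iff imageE)
    have st: "\<bar>t - s\<bar> < d" using \<mu>(2)[OF s(1)] s(2) by simp
    then have "s \<in> {0..T + 1}" using s(1) t d(2) by auto
    then have "\<bar>fluid_scaling m (W x) t $ i - z s $ i\<bar> < d"
      using component_le_norm_cart[of "fluid_scaling m (W x) t - z s" i] close[of s] s(2)
      by (simp add: dist_norm)
    moreover have "\<bar>z t $ i - z s $ i\<bar> \<le> L * d"
      using fluid_limit_lipschitz_abs[OF z s(1) t(1), of i] st L_le[of i] L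
      by (smt (verit) mult_mono)
    ultimately show ?thesis using dL by (simp add: algebra_simps)
  qed
  then show ?thesis using x unfolding m_def by blast
qed

text \<open>In a short window around \<open>t\<close> every visited state is close to
  \<open>z t\<close> after scaling, so all success probabilities there are within \<open>e\<close>
  of the fluid rate, and the queue increment determines the slope up to \<open>e\<close>.\<close>

theorem fluid_limit_has_derivative:
  assumes z: "fluid_limit E a v z" and t: "0 \<le> t" and pos: "\<And>i. 0 < z t $ i"
  shows "((\<lambda>s. z s $ i) has_real_derivative rate i - fluid_rate E (z t) i) (at t within {0..})"
proof -
  define D where "D = rate i - fluid_rate E (z t) i"
  \<comment> \<open>The window is two-sided but cut off at 0, which gives the right derivative when
    \<open>t = 0\<close>.\<close>
  have increment: "\<exists>\<eta>>0. \<forall>lo hi. 0 \<le> lo \<longrightarrow> lo \<le> hi \<longrightarrow> \<bar>lo - t\<bar> \<le> \<eta> \<longrightarrow> \<bar>hi - t\<bar> \<le> \<eta> \<longrightarrow>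
      \<bar>z hi $ i - z lo $ i - D * (hi - lo)\<bar> \<le> e * (hi - lo)" if e: "0 < e" for e
  proof -
    obtain \<delta> where \<delta>: "0 < \<delta>" and prob_near: "\<forall>\<^sub>F m in at_top. \<forall>w :: nat ^ 'k.
        (\<forall>j. \<bar>w $ j / m - z t $ j\<bar> < \<delta>) \<longrightarrow> \<bar>success_prob E w i - fluid_rate E (z t) i\<bar> < e"
      using success_prob_near_fluid_rate[OF pos e] by blast
    define L where "L = (\<Sum>i\<in>UNIV. \<bar>rate i\<bar> + 1)"
    have L_le: "\<bar>rate i\<bar> + 1 \<le> L" for i
      unfolding L_def by (intro member_le_sum) auto
    have L: "0 < L" using L_le[of undefined] by linarith
    define \<eta> where "\<eta> = \<delta> / (2 * L)"
    have \<eta>: "0 < \<eta>" using \<delta> L by (simp add: \<eta>_def)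
    have z_near: "\<bar>z s $ j - z t $ j\<bar> \<le> \<delta> / 2" if "0 \<le> s" "\<bar>s - t\<bar> \<le> \<eta>" for s j
    proof -
      have "\<bar>z s $ j - z t $ j\<bar> \<le> L * \<eta>"
        using fluid_limit_lipschitz_abs[OF z t that(1), of j] that(2) L_le[of j] L
        by (smt (verit) mult_mono)
      then show ?thesis using L by (simp add: \<eta>_def)
    qed
    have "\<bar>z hi $ i - z lo $ i - D * (hi - lo)\<bar> \<le> e * (hi - lo)"
      if lo: "0 \<le> lo" "lo \<le> hi" "\<bar>lo - t\<bar> \<le> \<eta>" "\<bar>hi - t\<bar> \<le> \<eta>" for lo hi
    proof (rule field_le_epsilon)
      fix e0 :: real assume e0: "0 < e0"
      \<comment> \<open>The first bound keeps the scaled queue within \<open>\<delta>\<close> of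
        \<open>z t\<close>; the second pays for four errors: increment estimate, rounding, and the
        comparison with \<open>z\<close> at \<open>lo\<close> and \<open>hi\<close>.\<close>
      define e' where "e' = min (\<delta> / 4) (e0 / 4)"
      have e': "0 < e'" "e' < \<delta> / 2" "4 * e' \<le> e0" using \<delta> e0 by (auto simp: e'_def)
      \<comment> \<open>Rounding changes the number of steps by at most 1 against
        \<open>m * (hi - lo)\<close>; this costs \<open>e\<close> in the probabilities and
        \<open>\<bar>D\<bar>\<close> in the drift.\<close>
      let ?C = "e + \<bar>D\<bar>"
      define Q where "Q m \<longleftrightarrow> 1 \<le> m \<and> ?C / e' \<le> m \<and>
        (\<forall>w. (\<forall>j. \<bar>w $ j / m - z t $ j\<bar> < \<delta>) \<longrightarrow> \<bar>success_prob E w i - fluid_rate E (z t) i\<bar> < e) \<and>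
        (\<forall>x. l1_norm (real_vec x) = m \<longrightarrow>
          (\<forall>n n'. n \<le> n' \<longrightarrow> real n' \<le> (hi + 1) * m \<longrightarrow>
            \<bar>real (W x n' $ i) - W x n $ i - rate i * (real n' - real n)
              + (\<Sum>k=n..<n'. success_prob E (W x k) i)\<bar> \<le> e' * m))" for m
      have "eventually Q at_top"
        unfolding Q_def by (intro eventually_conj eventually_ge_at_top queue_increment prob_near e'(1))
      then obtain x where Q: "Q (l1_norm (real_vec x))"
        and near': "\<forall>s i. 0 \<le> s \<longrightarrow> s \<le> hi \<longrightarrow>
          \<bar>fluid_scaling (l1_norm (real_vec x)) (W x) s $ i - z s $ i\<bar> \<le> e'"
        using fluid_limit_approx_uniform[OF z e'(1)] by blast
      define m where "m = l1_norm (real_vec x)"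
      have near: "\<And>s i. 0 \<le> s \<Longrightarrow> s \<le> hi \<Longrightarrow> \<bar>fluid_scaling m (W x) s $ i - z s $ i\<bar> \<le> e'"
        using near' unfolding m_def by blast
      have x: "1 \<le> m" "?C / e' \<le> m"
        and prob: "\<And>w. (\<And>j. \<bar>w $ j / m - z t $ j\<bar> < \<delta>) \<Longrightarrow>
          \<bar>success_prob E w i - fluid_rate E (z t) i\<bar> < e"
        and incr: "\<And>n n'. n \<le> n' \<Longrightarrow> real n' \<le> (hi + 1) * m \<Longrightarrow>
            \<bar>real (W x n' $ i) - W x n $ i - rate i * (real n' - real n)
              + (\<Sum>k=n..<n'. success_prob E (W x k) i)\<bar> \<le> e' * m"
        using Q unfolding Q_def m_def by auto
      define n n' where "n = nat \<lceil>m * lo\<rceil>" and "n' = nat \<lceil>m * hi\<rceil>"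
      have nonneg: "0 \<le> m * lo" using x(1) lo by simp
      have le: "m * lo \<le> m * hi" using x(1) lo by simp
      have n: "n \<le> n'" unfolding n_def n'_def by (intro nat_mono ceiling_mono le)
      have bounds: "m * lo \<le> real n" "real n < m * lo + 1" "m * hi \<le> real n'" "real n' < m * hi + 1"
        using nonneg le unfolding n_def n'_def by linarith+
      have n'_le: "real n' \<le> (hi + 1) * m" using x(1) bounds by (simp add: algebra_simps)
      have prob_k: "\<bar>success_prob E (W x k) i - fluid_rate E (z t) i\<bar> \<le> e" if k: "k \<in> {n..<n'}" for k
      proof (rule less_imp_le, rule prob)
        fix j
        define u where "u = k / m"
        have k_lo: "m * lo \<le> k" using bounds(1) k by auto
        \<comment> \<open>Ceilings fit the half-open index range: \<open>k < n'\<close> gives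
          \<open>k < m * hi\<close>, so \<open>k / m\<close> lies in the window, and there the
          scaled path is exactly \<open>W x k\<close> divided by \<open>m\<close>.\<close>
        have "int k < \<lceil>m * hi\<rceil>" using k unfolding n'_def by auto
        then have k_hi: "k < m * hi" by (simp add: less_ceiling_iff)
        have u: "lo \<le> u" "u \<le> hi" using k_lo k_hi x(1) by (auto simp: u_def field_simps)
        have "fluid_scaling m (W x) u $ j = W x k $ j / m"
          using x(1) by (simp add: fluid_scaling_def real_vec_def u_def)
        then have "\<bar>W x k $ j / m - z u $ j\<bar> \<le> e'" using near[of u j] u lo by simp
        moreover have "\<bar>z u $ j - z t $ j\<bar> \<le> \<delta> / 2" using u lo by (intro z_near) auto
        ultimately show "\<bar>W x k $ j / m - z t $ j\<bar> < \<delta>" using e' by linarith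
      qed
      have "\<bar>(\<Sum>k=n..<n'. success_prob E (W x k) i) - fluid_rate E (z t) i * (real n' - real n)\<bar>
          = \<bar>\<Sum>k=n..<n'. success_prob E (W x k) i - fluid_rate E (z t) i\<bar>"
        using n by (simp add: sum_subtractf of_nat_diff mult.commute)
      also have "\<dots> \<le> (\<Sum>k=n..<n'. e)"
        by (rule order_trans[OF sum_abs sum_mono]) (rule prob_k)
      also have "\<dots> = e * (real n' - real n)" using n by (simp add: of_nat_diff)
      finally have "\<bar>real (W x n' $ i) - W x n $ i - D * (real n' - real n)\<bar>
          \<le> e' * m + e * (real n' - real n)"
        using incr[OF n n'_le] unfolding D_def left_diff_distrib by linarith
      also have "\<dots> \<le> e' * m + e * (m * (hi - lo) + 1)"
        using bounds e by (intro add_left_mono mult_left_mono) (auto simp: algebra_simps)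
      finally have *: "\<bar>real (W x n' $ i) - W x n $ i - D * (real n' - real n)\<bar>
          \<le> e' * m + e * (m * (hi - lo) + 1)" .
      have "\<bar>D * (real n' - real n) - D * (m * (hi - lo))\<bar> = \<bar>D\<bar> * \<bar>(real n' - real n) - m * (hi - lo)\<bar>"
        by (simp add: abs_mult right_diff_distrib[symmetric])
      also have "\<dots> \<le> \<bar>D\<bar> * 1"
        using bounds by (intro mult_left_mono) (auto simp: right_diff_distrib abs_le_iff)
      finally have "\<bar>real (W x n' $ i) - W x n $ i - D * (m * (hi - lo))\<bar>
          \<le> e' * m + e * (m * (hi - lo)) + ?C"
        using * by (simp add: distrib_left)
      then have "\<bar>real (W x n' $ i) - W x n $ i - D * (m * (hi - lo))\<bar> / m
          \<le> (e' * m + e * (m * (hi - lo)) + ?C) / m"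
        using x(1) by (intro divide_right_mono) auto
      also have "\<dots> = e' + e * (hi - lo) + ?C / m"
        using x(1) by (simp add: field_simps)
      also have "?C / m \<le> e'"
        using x e'(1) by (simp add: field_simps)
      also have "\<bar>real (W x n' $ i) - W x n $ i - D * (m * (hi - lo))\<bar> / m
          = \<bar>(real (W x n' $ i) - W x n $ i - D * (m * (hi - lo))) / m\<bar>"
        using x(1) by simp
      also have "(real (W x n' $ i) - W x n $ i - D * (m * (hi - lo))) / m
          = fluid_scaling m (W x) hi $ i - fluid_scaling m (W x) lo $ i - D * (hi - lo)"
        using x(1) by (simp add: fluid_scaling_def real_vec_def n_def n'_def diff_divide_distrib)
      finally have "\<bar>fluid_scaling m (W x) hi $ i - fluid_scaling m (W x) lo $ i - D * (hi - lo)\<bar>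
          \<le> 2 * e' + e * (hi - lo)" by simp
      then show "\<bar>z hi $ i - z lo $ i - D * (hi - lo)\<bar> \<le> e * (hi - lo) + e0"
        using near[of lo i] near[of hi i] lo e'(3) by linarith
    qed
    then show ?thesis using \<eta> by blast
  qed
  show ?thesis
    unfolding has_field_derivative_iff D_def[symmetric]
  proof (rule tendstoI)
    fix e :: real assume "0 < e"
    then obtain \<eta> where \<eta>: "0 < \<eta>" and incr: "\<And>lo hi. 0 \<le> lo \<Longrightarrow> lo \<le> hi \<Longrightarrow> \<bar>lo - t\<bar> \<le> \<eta> \<Longrightarrow>
        \<bar>hi - t\<bar> \<le> \<eta> \<Longrightarrow> \<bar>z hi $ i - z lo $ i - D * (hi - lo)\<bar> \<le> e / 2 * (hi - lo)"
      using increment[of "e / 2"] by auto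
    show "\<forall>\<^sub>F s in at t within {0..}. dist ((z s $ i - z t $ i) / (s - t)) D < e"
      unfolding eventually_at
    proof (intro exI conjI ballI impI)
      fix s assume s: "s \<in> {0..}" "s \<noteq> t \<and> dist s t < \<eta>"
      have "\<bar>z s $ i - z t $ i - D * (s - t)\<bar> \<le> e / 2 * \<bar>s - t\<bar>"
      proof (cases "t \<le> s")
        case True
        then show ?thesis using incr[of t s] t s \<eta> by (simp add: dist_real_def)
      next
        case False
        then have "\<bar>z t $ i - z s $ i - D * (t - s)\<bar> \<le> e / 2 * (t - s)"
          using incr[of s t] t s \<eta> by (simp add: dist_real_def)
        moreover have "z t $ i - z s $ i - D * (t - s) = - (z s $ i - z t $ i - D * (s - t))"
          by (simp add: algebra_simps)
        ultimately show ?thesis using False by (simp only: abs_minus_cancel) simp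
      qed
      moreover have "(z s $ i - z t $ i) / (s - t) - D = (z s $ i - z t $ i - D * (s - t)) / (s - t)"
        using s by (simp add: field_simps)
      ultimately have "dist ((z s $ i - z t $ i) / (s - t)) D \<le> e / 2"
        using s by (simp add: dist_real_def abs_divide divide_le_eq)
      then show "dist ((z s $ i - z t $ i) / (s - t)) D < e" using \<open>0 < e\<close> by simp
    qed (rule \<eta>)
  qed
qed

theorem fluid_limit_lyapunov_derivative:
  assumes z: "fluid_limit E a v z" and t: "0 \<le> t" and pos: "\<And>i. 0 < z t $ i"
    and sym: "sym E" and card: "\<And>i. card (closed_nbhd E i) = V" and rate: "\<And>i. rate i = lam"
  shows "\<exists>D. ((\<lambda>s. \<Sum>i\<in>UNIV. (z s $ i)\<^sup>2) has_real_derivative D) (at t within {0..}) \<and>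
               D \<le> 2 * (lam - exp (- 1) / real V) * (\<Sum>i\<in>UNIV. z t $ i)"
proof (intro exI conjI)
  show "((\<lambda>s. \<Sum>i\<in>UNIV. (z s $ i)\<^sup>2) has_real_derivative
      (\<Sum>i\<in>UNIV. 2 * z t $ i * (rate i - fluid_rate E (z t) i))) (at t within {0..})"
    by (rule DERIV_sum)
      (auto intro!: derivative_eq_intros fluid_limit_has_derivative[OF z t pos])
  have "(\<Sum>i\<in>UNIV. 2 * z t $ i * (rate i - fluid_rate E (z t) i))
      = 2 * (lam * (\<Sum>i\<in>UNIV. z t $ i) - (\<Sum>i\<in>UNIV. z t $ i * fluid_rate E (z t) i))"
    by (simp add: rate sum_distrib_left sum_subtractf right_diff_distrib mult_ac)
  then show "(\<Sum>i\<in>UNIV. 2 * z t $ i * (rate i - fluid_rate E (z t) i))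
      \<le> 2 * (lam - exp (- 1) / real V) * (\<Sum>i\<in>UNIV. z t $ i)"
    using fluid_rate_lyapunov_bound[OF sym card pos] by (simp add: left_diff_distrib)
qed

end


section \<open>Concentration of the number of successes\<close>

text \<open>Reduces integrals to atoms, the form in which \<open>attempts_law\<close> is
  given.\<close>

lemma nn_integral_countable_valued:
  fixes X :: "'a \<Rightarrow> 'b::countable"
  assumes [measurable]: "X \<in> measurable M (count_space UNIV)"
  shows "(\<integral>\<^sup>+\<omega>. f (X \<omega>) \<partial>M) =
    (\<integral>\<^sup>+x. f x * emeasure M {\<omega> \<in> space M. X \<omega> = x} \<partial>count_space UNIV)"
proof -
  have "(\<integral>\<^sup>+\<omega>. f (X \<omega>) \<partial>M) =
      (\<integral>\<^sup>+\<omega>. \<integral>\<^sup>+x. f x * indicator {\<omega> \<in> space M. X \<omega> = x} \<omega> \<partial>count_space UNIV \<partial>M)"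
  proof (intro nn_integral_cong)
    fix \<omega> assume "\<omega> \<in> space M"
    then have "(\<integral>\<^sup>+x. f x * indicator {\<omega> \<in> space M. X \<omega> = x} \<omega> \<partial>count_space UNIV)
        = (\<integral>\<^sup>+x. f x * indicator {X \<omega>} x \<partial>count_space UNIV)"
      by (intro nn_integral_cong) (auto simp: indicator_def)
    also have "\<dots> = f (X \<omega>)"
      by (subst nn_integral_indicator_singleton) auto
    finally show "f (X \<omega>) = (\<integral>\<^sup>+x. f x * indicator {\<omega> \<in> space M. X \<omega> = x} \<omega> \<partial>count_space UNIV)" ..
  qed
  also have "\<dots> = (\<integral>\<^sup>+x. \<integral>\<^sup>+\<omega>. f x * indicator {\<omega> \<in> space M. X \<omega> = x} \<omega> \<partial>M \<partial>count_space UNIV)"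
    by (intro nn_integral_count_space_nn_integral) auto
  also have "\<dots> = (\<integral>\<^sup>+x. f x * emeasure M {\<omega> \<in> space M. X \<omega> = x} \<partial>count_space UNIV)"
    by (intro nn_integral_cong nn_integral_cmult_indicator) auto
  finally show ?thesis .
qed

lemma measurable_map_count_space:
  fixes f :: "'i \<Rightarrow> 'a \<Rightarrow> 'b::countable"
  assumes "\<And>k. f k \<in> measurable M (count_space UNIV)"
  shows "(\<lambda>\<omega>. map (\<lambda>k. f k \<omega>) ks) \<in> measurable M (count_space UNIV)"
proof (induction ks)
  case (Cons k ks)
  have "(\<lambda>\<omega>. y # map (\<lambda>k. f k \<omega>) ks) \<in> measurable M (count_space UNIV)" for y
    using Cons by (rule measurable_compose) simp
  then have "(\<lambda>\<omega>. f k \<omega> # map (\<lambda>k. f k \<omega>) ks) \<in> measurable M (count_space UNIV)"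
    by (rule measurable_compose_countable[OF _ assms])
  then show ?case by simp
qed simp

lemma measurable_Pair_count_space:
  fixes f :: "'a \<Rightarrow> 'b::countable" and g :: "'a \<Rightarrow> 'c::countable"
  assumes "f \<in> measurable M (count_space UNIV)" "g \<in> measurable M (count_space UNIV)"
  shows "(\<lambda>\<omega>. (f \<omega>, g \<omega>)) \<in> measurable M (count_space UNIV)"
proof -
  have "(\<lambda>\<omega>. (y, g \<omega>)) \<in> measurable M (count_space UNIV)" for y
    using assms(2) by (rule measurable_compose) simp
  then show ?thesis by (rule measurable_compose_countable[OF _ assms(1)])
qed

lemma queue_cong:
  assumes "\<And>k. 1 \<le> k \<Longrightarrow> k \<le> n \<Longrightarrow> a k = a' k" "\<And>k. k < n \<Longrightarrow> v k = v' k"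
  shows "queue E a v x n = queue E a' v' x n"
  using assms
proof (induction n)
  case (Suc n)
  then have "queue E a v x n = queue E a' v' x n" "a (Suc n) = a' (Suc n)" "v n = v' n" by auto
  then show ?case by simp
qed simp

text \<open>Turns the product in \<open>attempts_law\<close> into a genuine distribution on vectors,
  against which one can integrate and apply Hoeffding's lemma.\<close>

definition attempt_pmf :: "('k::finite \<times> 'k) set \<Rightarrow> nat ^ 'k \<Rightarrow> (nat ^ 'k) pmf" where
  "attempt_pmf E w = map_pmf vec_lambda
     (Pi_pmf UNIV 0 (\<lambda>i. binomial_pmf (w $ i) (1 / (\<Sum>j\<in>closed_nbhd E i. real (w $ j)))))"

lemma pmf_attempt_pmf:
  fixes E :: "('k::finite \<times> 'k) set"
  shows "pmf (attempt_pmf E w) u =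
    (\<Prod>i\<in>UNIV. pmf (binomial_pmf (w $ i) (1 / (\<Sum>j\<in>closed_nbhd E i. real (w $ j)))) (u $ i))"
proof -
  have "inj (vec_lambda :: ('k \<Rightarrow> nat) \<Rightarrow> _)"
    by (auto simp: inj_on_def vec_lambda_inject)
  from pmf_map_inj'[OF this, of _ "vec_nth u"] show ?thesis
    by (simp add: attempt_pmf_def vec_nth_inverse pmf_Pi)
qed

lemma attempts_le_of_set_pmf:
  assumes "u \<in> set_pmf (attempt_pmf E w)"
  shows "u $ i \<le> w $ i"
proof (rule ccontr)
  assume "\<not> u $ i \<le> w $ i"
  define s where "s = (\<Sum>j\<in>closed_nbhd E i. w $ j)"
  \<comment> \<open>This also covers an empty neighbourhood, where \<open>1 / 0 = 0\<close> is a
    legitimate parameter.\<close>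
  have "1 / real s \<le> 1" by (cases s) auto
  then have "pmf (binomial_pmf (w $ i) (1 / real s)) (u $ i) = 0"
    using \<open>\<not> u $ i \<le> w $ i\<close> by (simp add: pmf_binomial)
  then have "pmf (binomial_pmf (w $ i) (1 / (\<Sum>j\<in>closed_nbhd E i. real (w $ j)))) (u $ i) = 0"
    by (simp add: s_def)
  then have "pmf (attempt_pmf E w) u = 0"
    unfolding pmf_attempt_pmf by (intro prod_zero) auto
  then show False using assms by (simp add: set_pmf_iff)
qed

lemma success_eq:
  "success E u i = of_bool (\<forall>j\<in>closed_nbhd E i. u $ j = of_bool (j = i))"
proof -
  have "(\<Prod>j\<in>closed_nbhd E i - {i}. of_bool (u $ j = 0) :: nat)
      = of_bool (\<forall>j\<in>closed_nbhd E i - {i}. u $ j = 0)"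
  proof (cases "\<forall>j\<in>closed_nbhd E i - {i}. u $ j = 0")
    case False
    then show ?thesis by (auto intro!: prod_zero)
  qed simp
  then show ?thesis
    using self_in_closed_nbhd[of i E] by (auto simp: success_def)
qed

text \<open>A success is a product event: one prescribed value at each vertex of the neighbourhood,
  no restriction elsewhere, where the factors are 1.\<close>

lemma expectation_success:
  "measure_pmf.expectation (attempt_pmf E w) (\<lambda>u. real (success E u i)) = success_prob E w i"
proof -
  define B where "B j = (if j \<in> closed_nbhd E i then {of_bool (j = i)} else (UNIV :: nat set))" for j
  define P where "P j = binomial_pmf (w $ j) (1 / (\<Sum>l\<in>closed_nbhd E j. real (w $ l)))" for j
  have "measure_pmf.expectation (attempt_pmf E w) (\<lambda>u. real (success E u i))
      = measure_pmf.expectation (attempt_pmf E w) (indicator {u. \<forall>j. u $ j \<in> B j})"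
    by (intro Bochner_Integration.integral_cong)
      (auto simp: success_eq B_def indicator_def split: if_splits)
  also have "\<dots> = measure_pmf.prob (Pi_pmf UNIV 0 P) (Pi UNIV B)"
    by (simp add: attempt_pmf_def P_def[abs_def] Pi_def vimage_def)
  also have "\<dots> = (\<Prod>j\<in>UNIV. measure_pmf.prob (P j) (B j))"
    by (rule measure_Pi_pmf_Pi) simp
  also have "\<dots> = (\<Prod>j\<in>UNIV. if j \<in> closed_nbhd E i then pmf (P j) (of_bool (j = i)) else 1)"
    by (intro prod.cong) (auto simp: B_def measure_pmf_single)
  also have "\<dots> = success_prob E w i"
    by (simp add: success_prob_def P_def prod.If_cases)
  finally show ?thesis .
qed

text \<open>Hoeffding's lemma for a variable in an interval of length 1; the sign
  \<open>\<sigma>\<close> covers both tails.\<close>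

lemma exp_moment_success:
  assumes \<sigma>: "\<sigma> = 1 \<or> \<sigma> = - 1" and \<theta>: "0 < \<theta>"
  shows "(\<integral>\<^sup>+u. ennreal (exp (\<theta> * (\<sigma> * (real (success E u i) - success_prob E w i)))) \<partial>attempt_pmf E w)
    \<le> ennreal (exp (\<theta>\<^sup>2 / 8))"
proof -
  interpret interval_bounded_random_variable "measure_pmf (attempt_pmf E w)"
    "\<lambda>u. \<sigma> * real (success E u i)" "min 0 \<sigma>" "max 0 \<sigma>"
    by unfold_locales (use \<sigma> in \<open>auto simp: success_eq\<close>)
  have "measure_pmf.expectation (attempt_pmf E w) (\<lambda>u. \<sigma> * real (success E u i))
      = \<sigma> * success_prob E w i"
    by (simp add: expectation_success)
  then show ?thesis
    using Hoeffdings_lemma_nn_integral[OF \<theta>] \<sigma> by (auto simp: right_diff_distrib)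
qed

text \<open>The first arrival recorded in a history is \<open>A 1\<close>.\<close>

definition history_arrivals :: "(nat ^ 'k) list \<times> (nat ^ 'k) list \<Rightarrow> nat \<Rightarrow> nat ^ 'k" where
  "history_arrivals h k = fst h ! (k - 1)"

definition history_attempts :: "(nat ^ 'k) list \<times> (nat ^ 'k) list \<Rightarrow> nat \<Rightarrow> nat ^ 'k" where
  "history_attempts h k = snd h ! k"

text \<open>The martingale of the concentration argument, as a function of sequences so that it can
  be evaluated on a realisation and on a recorded history alike.\<close>

definition success_deviation ::
  "('k::finite \<times> 'k) set \<Rightarrow> nat ^ 'k \<Rightarrow> 'k \<Rightarrow> nat \<Rightarrow> (nat \<Rightarrow> nat ^ 'k) \<Rightarrow> (nat \<Rightarrow> nat ^ 'k) \<Rightarrow> real"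
where
  "success_deviation E x i n a v =
    (\<Sum>k<n. real (success E (v k) i) - success_prob E (queue E a v x k) i)"

lemma success_deviation_cong:
  assumes "\<And>k. 1 \<le> k \<Longrightarrow> k \<le> n \<Longrightarrow> a k = a' k" "\<And>k. k < n \<Longrightarrow> v k = v' k"
  shows "success_deviation E x i n a v = success_deviation E x i n a' v'"
  unfolding success_deviation_def
proof (intro sum.cong refl)
  fix k assume "k \<in> {..<n}"
  then show "real (success E (v k) i) - success_prob E (queue E a v x k) i
      = real (success E (v' k) i) - success_prob E (queue E a' v' x k) i"
    using assms queue_cong[of k a a' v v' E x] by simp
qed

section \<open>Exponential moments along the history of a chain\<close>

context medium_access
begin

definition history :: "nat ^ 'k \<Rightarrow> nat \<Rightarrow> 'w \<Rightarrow> (nat ^ 'k) list \<times> (nat ^ 'k) list" where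
  "history x n \<omega> = (map (\<lambda>k. A k \<omega>) [1..<Suc n], map (\<lambda>k. N x k \<omega>) [0..<n])"

abbreviation state :: "nat ^ 'k \<Rightarrow> nat \<Rightarrow> 'w \<Rightarrow> nat ^ 'k" where
  "state x n \<omega> \<equiv> queue E (\<lambda>k. A k \<omega>) (\<lambda>k. N x k \<omega>) x n"

abbreviation deviation :: "nat ^ 'k \<Rightarrow> 'k \<Rightarrow> nat \<Rightarrow> 'w \<Rightarrow> real" where
  "deviation x i n \<omega> \<equiv> success_deviation E x i n (\<lambda>k. A k \<omega>) (\<lambda>k. N x k \<omega>)"

lemma arrivals_measurable [measurable]: "A n \<in> measurable M (count_space UNIV)"
  using arrivals_indep unfolding indep_vars_def by blast

declare attempts_measurable [measurable]

lemma history_measurable [measurable]: "history x n \<in> measurable M (count_space UNIV)"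
  unfolding history_def
  by (intro measurable_Pair_count_space measurable_map_count_space arrivals_measurable
      attempts_measurable)

lemma history_arrivals_history: "1 \<le> k \<Longrightarrow> k \<le> n \<Longrightarrow> history_arrivals (history x n \<omega>) k = A k \<omega>"
  using nth_upt[of 1 "k - 1" "Suc n"] by (simp add: history_arrivals_def history_def del: upt_Suc)

lemma history_attempts_history: "k < n \<Longrightarrow> history_attempts (history x n \<omega>) k = N x k \<omega>"
  by (simp add: history_attempts_def history_def)

lemma state_eq_history:
  "state x n \<omega> = queue E (history_arrivals (history x n \<omega>)) (history_attempts (history x n \<omega>)) x n"
  by (intro queue_cong) (simp_all add: history_arrivals_history history_attempts_history)

lemma deviation_eq_history:
  "deviation x i n \<omega> =
    success_deviation E x i n (history_arrivals (history x n \<omega>)) (history_attempts (history x n \<omega>))"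
  by (intro success_deviation_cong) (simp_all add: history_arrivals_history history_attempts_history)

lemma deviation_measurable [measurable]: "deviation x i n \<in> borel_measurable M"
  unfolding deviation_eq_history by (rule measurable_compose[OF history_measurable]) simp

text \<open>The tower property: the attempts at time \<open>n\<close> are integrated out against
  their law given the past, by summing \<open>attempts_law\<close> over the atoms of the
  history.\<close>

lemma nn_integral_history_attempts:
  "(\<integral>\<^sup>+\<omega>. G (history x n \<omega>) (N x n \<omega>) \<partial>M) =
   (\<integral>\<^sup>+\<omega>. \<integral>\<^sup>+u. G (history x n \<omega>) u \<partial>attempt_pmf E (state x n \<omega>) \<partial>M)"
proof -
  define st where "st h = queue E (history_arrivals h) (history_attempts h) x n" for h
  have st: "state x n \<omega> = st (history x n \<omega>)" for \<omega>
    unfolding st_def by (rule state_eq_history)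
  have law: "emeasure M {\<omega> \<in> space M. (history x n \<omega>, N x n \<omega>) = (h, u)}
      = emeasure M {\<omega> \<in> space M. history x n \<omega> = h} * pmf (attempt_pmf E (st h)) u" for h u
  proof -
    \<comment> \<open>The history determines the state, so the condition on the state in
      \<open>attempts_law\<close> can be inserted with \<open>w = st h\<close>.\<close>
    have "{\<omega> \<in> space M. (history x n \<omega>, N x n \<omega>) = (h, u)}
        = {\<omega> \<in> space M. history x n \<omega> = h \<and> state x n \<omega> = st h \<and> N x n \<omega> = u}"
      "{\<omega> \<in> space M. history x n \<omega> = h} = {\<omega> \<in> space M. history x n \<omega> = h \<and> state x n \<omega> = st h}"
      unfolding st by auto
    then show ?thesis
      using attempts_law[where x = x and n = n and h = h and w = "st h" and v = u]
      by (simp add: emeasure_eq_measure pmf_attempt_pmf history_def ennreal_mult[symmetric] prod_nonneg)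
  qed
  have "(\<integral>\<^sup>+\<omega>. G (history x n \<omega>) (N x n \<omega>) \<partial>M)
      = (\<integral>\<^sup>+p. G (fst p) (snd p) * emeasure M {\<omega> \<in> space M. (history x n \<omega>, N x n \<omega>) = p} \<partial>count_space UNIV)"
    using nn_integral_countable_valued[OF
        measurable_Pair_count_space[OF history_measurable attempts_measurable],
        where f = "\<lambda>p. G (fst p) (snd p)"] by simp
  also have "\<dots> = (\<integral>\<^sup>+h. \<integral>\<^sup>+u. G h u *
      (emeasure M {\<omega> \<in> space M. history x n \<omega> = h} * pmf (attempt_pmf E (st h)) u)
      \<partial>count_space UNIV \<partial>count_space UNIV)"
    unfolding nn_integral_fst_count_space[symmetric] by (simp only: law fst_conv snd_conv)
  also have "\<dots> = (\<integral>\<^sup>+h. (\<integral>\<^sup>+u. G h u \<partial>attempt_pmf E (st h)) *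
      emeasure M {\<omega> \<in> space M. history x n \<omega> = h} \<partial>count_space UNIV)"
    unfolding nn_integral_measure_pmf
    by (intro nn_integral_cong) (simp add: nn_integral_multc[symmetric] mult_ac)
  also have "\<dots> = (\<integral>\<^sup>+\<omega>. \<integral>\<^sup>+u. G (history x n \<omega>) u \<partial>attempt_pmf E (st (history x n \<omega>)) \<partial>M)"
    by (rule nn_integral_countable_valued[symmetric]) measurable
  finally show ?thesis unfolding st .
qed

text \<open>Binomial attempts almost surely do not exceed the queue, and a success at
  \<open>i\<close> means exactly one attempt there.\<close>

lemma AE_success_le_state: "AE \<omega> in M. success E (N x n \<omega>) i \<le> state x n \<omega> $ i"
proof -
  define st where "st h = queue E (history_arrivals h) (history_attempts h) x n" for h
  have st: "state x n \<omega> = st (history x n \<omega>)" for \<omega>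
    unfolding st_def by (rule state_eq_history)
  have "(\<integral>\<^sup>+\<omega>. of_bool (\<not> N x n \<omega> $ i \<le> st (history x n \<omega>) $ i) \<partial>M)
      = (\<integral>\<^sup>+\<omega>. \<integral>\<^sup>+u. of_bool (\<not> u $ i \<le> st (history x n \<omega>) $ i)
          \<partial>attempt_pmf E (st (history x n \<omega>)) \<partial>M)"
    using nn_integral_history_attempts[where G = "\<lambda>h u. of_bool (\<not> u $ i \<le> st h $ i)"] by (simp add: st)
  also have "\<dots> = (\<integral>\<^sup>+\<omega>. 0 \<partial>M)"
    by (intro nn_integral_cong)
      (auto simp: nn_integral_0_iff_AE AE_measure_pmf_iff dest: attempts_le_of_set_pmf[where i = i])
  finally have "(\<integral>\<^sup>+\<omega>. of_bool (\<not> N x n \<omega> $ i \<le> st (history x n \<omega>) $ i) \<partial>M) = 0" by simp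
  then have "AE \<omega> in M. (of_bool (\<not> N x n \<omega> $ i \<le> st (history x n \<omega>) $ i) :: ennreal) = 0"
    using measurable_compose[OF measurable_Pair_count_space[OF history_measurable attempts_measurable],
        where g = "\<lambda>p. of_bool (\<not> snd p $ i \<le> st (fst p) $ i) :: ennreal"]
    by (subst (asm) nn_integral_0_iff_AE) auto
  then show ?thesis
    unfolding st by eventually_elim (auto simp: success_eq split: if_splits)
qed

text \<open>Given the history, each step multiplies the exponential moment by at most
  \<open>exp (\<theta>\<^sup>2 / 8)\<close>.\<close>

lemma exp_moment_deviation:
  assumes \<sigma>: "\<sigma> = 1 \<or> \<sigma> = - 1" and \<theta>: "0 < \<theta>"
  shows "(\<integral>\<^sup>+\<omega>. ennreal (exp (\<theta> * (\<sigma> * deviation x i n \<omega>))) \<partial>M) \<le> ennreal (exp (\<theta>\<^sup>2 / 8 * n))"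
proof (induction n)
  case 0
  then show ?case by (simp add: success_deviation_def emeasure_space_1)
next
  case (Suc n)
  let ?a = history_arrivals and ?v = history_attempts
  define d where "d h = exp (\<theta> * (\<sigma> * success_deviation E x i n (?a h) (?v h)))" for h
  define st where "st h = queue E (?a h) (?v h) x n" for h
  have d: "exp (\<theta> * (\<sigma> * deviation x i n \<omega>)) = d (history x n \<omega>)" for \<omega>
    unfolding d_def by (subst deviation_eq_history) simp
  have st: "state x n \<omega> = st (history x n \<omega>)" for \<omega>
    unfolding st_def by (rule state_eq_history)
  define e where "e h u = exp (\<theta> * (\<sigma> * (real (success E u i) - success_prob E (st h) i)))" for h u
  have "exp (\<theta> * (\<sigma> * deviation x i (Suc n) \<omega>)) = d (history x n \<omega>) * e (history x n \<omega>) (N x n \<omega>)" for \<omega>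
    unfolding d[symmetric] e_def st[symmetric] exp_add[symmetric]
    by (simp add: success_deviation_def algebra_simps)
  then have "(\<integral>\<^sup>+\<omega>. ennreal (exp (\<theta> * (\<sigma> * deviation x i (Suc n) \<omega>))) \<partial>M)
      = (\<integral>\<^sup>+\<omega>. ennreal (d (history x n \<omega>)) * ennreal (e (history x n \<omega>) (N x n \<omega>)) \<partial>M)"
    by (simp add: ennreal_mult d_def e_def)
  also have "\<dots> = (\<integral>\<^sup>+\<omega>. \<integral>\<^sup>+u. ennreal (d (history x n \<omega>)) * ennreal (e (history x n \<omega>) u)
      \<partial>attempt_pmf E (state x n \<omega>) \<partial>M)"
    by (rule nn_integral_history_attempts)
  also have "\<dots> \<le> (\<integral>\<^sup>+\<omega>. ennreal (d (history x n \<omega>)) * ennreal (exp (\<theta>\<^sup>2 / 8)) \<partial>M)"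
  proof (intro nn_integral_mono)
    fix \<omega>
    have "(\<integral>\<^sup>+u. ennreal (d (history x n \<omega>)) * ennreal (e (history x n \<omega>) u) \<partial>attempt_pmf E (state x n \<omega>))
        = ennreal (d (history x n \<omega>)) * (\<integral>\<^sup>+u. ennreal (e (history x n \<omega>) u) \<partial>attempt_pmf E (state x n \<omega>))"
      by (rule nn_integral_cmult) simp
    also have "\<dots> \<le> ennreal (d (history x n \<omega>)) * ennreal (exp (\<theta>\<^sup>2 / 8))"
      unfolding e_def st[symmetric] by (intro mult_left_mono exp_moment_success[OF \<sigma> \<theta>]) simp
    finally show "(\<integral>\<^sup>+u. ennreal (d (history x n \<omega>)) * ennreal (e (history x n \<omega>) u)
        \<partial>attempt_pmf E (state x n \<omega>)) \<le> ennreal (d (history x n \<omega>)) * ennreal (exp (\<theta>\<^sup>2 / 8))" .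
  qed
  also have "\<dots> = (\<integral>\<^sup>+\<omega>. ennreal (exp (\<theta> * (\<sigma> * deviation x i n \<omega>))) \<partial>M) * ennreal (exp (\<theta>\<^sup>2 / 8))"
    unfolding d[symmetric] by (rule nn_integral_multc) measurable
  also have "\<dots> \<le> ennreal (exp (\<theta>\<^sup>2 / 8 * n)) * ennreal (exp (\<theta>\<^sup>2 / 8))"
    using Suc by (rule mult_right_mono) simp
  also have "\<dots> = ennreal (exp (\<theta>\<^sup>2 / 8 * Suc n))"
    by (simp add: ennreal_mult[symmetric] exp_add[symmetric] distrib_left)
  finally show ?case .
qed

lemma prob_deviation_ge:
  assumes b: "0 < b" and n: "real n \<le> c" "0 < c"
  shows "prob {\<omega> \<in> space M. b \<le> \<bar>deviation x i n \<omega>\<bar>} \<le> 2 * exp (- (2 * b\<^sup>2 / c))"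
proof -
  \<comment> \<open>The minimiser of \<open>\<theta>\<^sup>2 / 8 * c - \<theta> * b\<close>, with
    minimum \<open>- (2 * b\<^sup>2 / c)\<close>.\<close>
  define \<theta> where "\<theta> = 4 * b / c"
  have \<theta>: "0 < \<theta>" using b n(2) by (simp add: \<theta>_def)
  have one_sided: "prob {\<omega> \<in> space M. b \<le> \<sigma> * deviation x i n \<omega>} \<le> exp (- (2 * b\<^sup>2 / c))"
    if \<sigma>: "\<sigma> = 1 \<or> \<sigma> = - 1" for \<sigma> :: real
  proof -
    have "emeasure M {\<omega> \<in> space M. b \<le> \<sigma> * deviation x i n \<omega>}
        \<le> ennreal (exp (- \<theta> * b)) * (\<integral>\<^sup>+\<omega>\<in>space M. ennreal (exp (\<theta> * (\<sigma> * deviation x i n \<omega>))) \<partial>M)"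
      by (intro Chernoff_ineq_nn_integral_ge \<theta>) auto
    also have "(\<integral>\<^sup>+\<omega>\<in>space M. ennreal (exp (\<theta> * (\<sigma> * deviation x i n \<omega>))) \<partial>M)
        = (\<integral>\<^sup>+\<omega>. ennreal (exp (\<theta> * (\<sigma> * deviation x i n \<omega>))) \<partial>M)"
      by (intro nn_integral_cong) simp
    also have "ennreal (exp (- \<theta> * b)) * \<dots> \<le> ennreal (exp (- \<theta> * b)) * ennreal (exp (\<theta>\<^sup>2 / 8 * n))"
      by (intro mult_left_mono exp_moment_deviation[OF \<sigma> \<theta>]) simp
    also have "\<dots> = ennreal (exp (\<theta>\<^sup>2 / 8 * n - \<theta> * b))"
      by (simp add: ennreal_mult[symmetric] exp_add[symmetric])
    also have "\<theta>\<^sup>2 / 8 * n - \<theta> * b \<le> \<theta>\<^sup>2 / 8 * c - \<theta> * b"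
      using n by (intro diff_right_mono mult_left_mono) auto
    also have "\<theta>\<^sup>2 / 8 * c - \<theta> * b = - (2 * b\<^sup>2 / c)"
      using n(2) by (simp add: \<theta>_def power2_eq_square field_simps)
    finally show ?thesis
      by (simp add: emeasure_eq_measure)
  qed
  have "{\<omega> \<in> space M. b \<le> \<bar>deviation x i n \<omega>\<bar>} =
      {\<omega> \<in> space M. b \<le> 1 * deviation x i n \<omega>} \<union> {\<omega> \<in> space M. b \<le> - 1 * deviation x i n \<omega>}"
    by auto
  then have "prob {\<omega> \<in> space M. b \<le> \<bar>deviation x i n \<omega>\<bar>} \<le>
      prob {\<omega> \<in> space M. b \<le> 1 * deviation x i n \<omega>} + prob {\<omega> \<in> space M. b \<le> - 1 * deviation x i n \<omega>}"
    using measure_Un_le[of "{\<omega> \<in> space M. b \<le> 1 * deviation x i n \<omega>}" M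
        "{\<omega> \<in> space M. b \<le> - 1 * deviation x i n \<omega>}"] by simp
  also have "\<dots> \<le> exp (- (2 * b\<^sup>2 / c)) + exp (- (2 * b\<^sup>2 / c))"
    by (intro add_mono one_sided) auto
  finally show ?thesis by simp
qed

end

section \<open>Uniformity over initial states and the almost sure event\<close>

lemma l1_norm_real_vec: "l1_norm (real_vec x) = real (\<Sum>i\<in>UNIV. x $ i)"
  by (simp add: l1_norm_def real_vec_def)

lemma finite_card_norm_sphere:
  "finite {x :: nat ^ 'k::finite. (\<Sum>i\<in>UNIV. x $ i) = m} \<and>
   card {x :: nat ^ 'k. (\<Sum>i\<in>UNIV. x $ i) = m} \<le> (m + 1) ^ CARD('k)"
proof -
  let ?S = "{x :: nat ^ 'k. (\<Sum>i\<in>UNIV. x $ i) = m}" and ?F = "PiE (UNIV :: 'k set) (\<lambda>_. {..m})"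
  have sub: "?S \<subseteq> vec_lambda ` ?F"
  proof
    fix x assume "x \<in> ?S"
    then have "x $ i \<le> m" for i
      using member_le_sum[of i UNIV "\<lambda>i. x $ i"] by simp
    then have "vec_nth x \<in> ?F" by auto
    then show "x \<in> vec_lambda ` ?F" by (metis imageI vec_nth_inverse)
  qed
  have fin: "finite ?F" by (intro finite_PiE) auto
  have "card ?S \<le> card ?F"
    using card_mono[OF _ sub] card_image_le[OF fin, of vec_lambda] fin by fastforce
  also have "card ?F = (m + 1) ^ CARD('k)" by (simp add: card_PiE)
  finally show ?thesis using finite_subset[OF sub] fin by auto
qed

lemma summable_poly_exp_decay:
  fixes q c :: real
  assumes "0 < c" "0 < q"
  shows "summable (\<lambda>m. (real m + 1) ^ K * ((q * real m + 1) * (2 * exp (- (c * real m)))))"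
proof (rule summable_comparison_test_bigo)
  show "summable (\<lambda>m. norm (1 / real m ^ 2))"
    using inverse_power_summable[of 2] by (simp add: field_simps)
  show "(\<lambda>m. (real m + 1) ^ K * ((q * real m + 1) * (2 * exp (- (c * real m))))) \<in> O(\<lambda>m. 1 / real m ^ 2)"
    using assms by real_asymp
qed

context medium_access
begin

text \<open>Deviation \<open>m / q\<close> within \<open>q * m\<close> steps has exponent
  \<open>2 / q ^ 3 * m\<close>, which beats the polynomial number of pairs of initial state and
  time. A single \<open>q\<close> serves as horizon and as inverse tolerance, so countably many
  values suffice.\<close>

lemma AE_success_average:
  fixes q :: nat
  assumes q: "0 < q"
  shows "AE \<omega> in M. \<forall>\<^sub>F m in sequentially. \<forall>x. (\<Sum>i\<in>UNIV. x $ i) = m \<longrightarrow>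
    (\<forall>n\<le>q * m. \<bar>deviation x i n \<omega>\<bar> \<le> m / q)"
proof -
  define S where "S m = {x :: nat ^ 'k. (\<Sum>i\<in>UNIV. x $ i) = m}" for m
  have S: "finite (S m)" "card (S m) \<le> (m + 1) ^ CARD('k)" for m
    using finite_card_norm_sphere[of m, where 'k = 'k] unfolding S_def by auto
  define B where "B m = (\<Union>x\<in>S m. \<Union>n\<le>q * m. {\<omega> \<in> space M. real m / q \<le> \<bar>deviation x i n \<omega>\<bar>})" for m
  have [measurable]: "B m \<in> events" for m
    unfolding B_def using S(1) by (intro sets.finite_UN) auto
  have B_le: "prob (B m) \<le> (real m + 1) ^ CARD('k) * ((q * real m + 1) * (2 * exp (- (2 / q ^ 3 * m))))"
    if m: "0 < m" for m
  proof -
    let ?b = "2 * exp (- (2 / real q ^ 3 * m))"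
    have "prob (B m) \<le> (\<Sum>x\<in>S m. prob (\<Union>n\<le>q * m. {\<omega> \<in> space M. real m / q \<le> \<bar>deviation x i n \<omega>\<bar>}))"
      unfolding B_def by (intro measure_UNION_le S(1) sets.finite_UN) auto
    also have "\<dots> \<le> (\<Sum>x\<in>S m. \<Sum>n\<le>q * m. prob {\<omega> \<in> space M. real m / q \<le> \<bar>deviation x i n \<omega>\<bar>})"
      by (intro sum_mono measure_UNION_le) auto
    also have "\<dots> \<le> (\<Sum>x\<in>S m. \<Sum>n\<le>q * m. ?b)"
    proof (intro sum_mono)
      fix x n assume "n \<in> {..q * m}"
      then have "real n \<le> real (q * m)" by (simp only: of_nat_le_iff atMost_iff)
      then have "prob {\<omega> \<in> space M. real m / q \<le> \<bar>deviation x i n \<omega>\<bar>}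
          \<le> 2 * exp (- (2 * (real m / q)\<^sup>2 / real (q * m)))"
        using m q by (intro prob_deviation_ge) auto
      also have "2 * (real m / q)\<^sup>2 / real (q * m) = 2 / real q ^ 3 * m"
        using m q by (simp add: power2_eq_square power3_eq_cube field_simps)
      finally show "prob {\<omega> \<in> space M. real m / q \<le> \<bar>deviation x i n \<omega>\<bar>} \<le> ?b" .
    qed
    also have "\<dots> = card (S m) * ((q * real m + 1) * ?b)"
      by (simp add: algebra_simps)
    also have "\<dots> \<le> real ((m + 1) ^ CARD('k)) * ((q * real m + 1) * ?b)"
      using S(2)[of m] by (intro mult_right_mono) (auto simp del: of_nat_power)
    finally show ?thesis by (simp add: add.commute)
  qed
  have "AE \<omega> in M. \<forall>\<^sub>F m in sequentially. \<omega> \<in> space M - B m"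
  proof (rule borel_cantelli_AE1)
    show "summable (\<lambda>m. prob (B m))"
    proof (rule summable_comparison_test)
      show "\<exists>n0. \<forall>m\<ge>n0. norm (prob (B m))
          \<le> (real m + 1) ^ CARD('k) * ((q * real m + 1) * (2 * exp (- (2 / q ^ 3 * m))))"
        using B_le by (intro exI[of _ 1]) auto
      show "summable (\<lambda>m. (real m + 1) ^ CARD('k) * ((q * real m + 1) * (2 * exp (- (2 / q ^ 3 * m)))))"
        using q by (intro summable_poly_exp_decay) auto
    qed
  qed (auto simp: emeasure_eq_measure)
  then show ?thesis
  proof (rule AE_mp, intro AE_I2 impI)
    fix \<omega> assume "\<omega> \<in> space M" "\<forall>\<^sub>F m in sequentially. \<omega> \<in> space M - B m"
    from this(2) show "\<forall>\<^sub>F m in sequentially. \<forall>x. (\<Sum>i\<in>UNIV. x $ i) = m \<longrightarrow>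
        (\<forall>n\<le>q * m. \<bar>deviation x i n \<omega>\<bar> \<le> m / q)"
    proof eventually_elim
      case (elim m)
      have "\<omega> \<notin> B m" "\<omega> \<in> space M" using elim by auto
      then show ?case unfolding B_def S_def by (auto simp: not_le intro: less_imp_le)
    qed
  qed
qed

lemma AE_arrivals_average: "AE \<omega> in M. (\<lambda>n. (\<Sum>k<n. real (A (Suc k) \<omega> $ i)) / n) \<longlonglongrightarrow> rate i"
proof -
  have distr: "distr M borel (\<lambda>\<omega>. real (A k \<omega> $ i))
      = distr (distr M (count_space UNIV) (A k)) borel (\<lambda>v. real (v $ i))" for k
    by (subst distr_distr) (auto simp: comp_def)
  have "AE \<omega> in M. (\<lambda>n. (\<Sum>k<n. real (A k \<omega> $ i)) / n) \<longlonglongrightarrow> expectation (\<lambda>\<omega>. real (A 0 \<omega> $ i))"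
  proof (rule strong_law_of_large_numbers)
    show "indep_vars (\<lambda>_. borel) (\<lambda>k \<omega>. real (A k \<omega> $ i)) UNIV"
      by (rule indep_vars_compose2[OF arrivals_indep]) simp
    show "distr M borel (\<lambda>\<omega>. real (A k \<omega> $ i)) = distr M borel (\<lambda>\<omega>. real (A 0 \<omega> $ i))" for k
      unfolding distr using arrivals_ident[of k] by simp
  qed (rule arrivals_integrable)
  then show ?thesis
  proof (rule AE_mp, intro AE_I2 impI)
    fix \<omega> assume "(\<lambda>n. (\<Sum>k<n. real (A k \<omega> $ i)) / n) \<longlonglongrightarrow> expectation (\<lambda>\<omega>. real (A 0 \<omega> $ i))"
    then have "(\<lambda>n. (\<Sum>k<n. real (A k \<omega> $ i)) / n) \<longlonglongrightarrow> rate i"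
      by (simp only: arrivals_mean)
    \<comment> \<open>The queue is driven by \<open>A 1, A 2, ...\<close>, so the average is
      shifted: rescale by \<open>Suc n / n\<close> and drop \<open>A 0\<close>, both harmless in the
      limit.\<close>
    from LIMSEQ_Suc[OF this]
    have "(\<lambda>n. (\<Sum>k<Suc n. real (A k \<omega> $ i)) / Suc n * (real (Suc n) / n) - real (A 0 \<omega> $ i) / n)
        \<longlonglongrightarrow> rate i * 1 - 0"
      by (intro tendsto_intros LIMSEQ_Suc_n_over_n lim_const_over_n)
    moreover have "a / Suc n * (real (Suc n) / n) - b / n = (a - b) / n" for a b :: real and n
      by (simp add: diff_divide_distrib del: of_nat_Suc)
    ultimately show "(\<lambda>n. (\<Sum>k<n. real (A (Suc k) \<omega> $ i)) / n) \<longlonglongrightarrow> rate i"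
      by (simp only: sum.lessThan_Suc_shift) simp
  qed
qed

theorem AE_fluid_realisation: "AE \<omega> in M. fluid_realisation E rate (\<lambda>n. A n \<omega>) (\<lambda>x n. N x n \<omega>)"
proof -
  have "AE \<omega> in M. (\<forall>i. (\<lambda>n. (\<Sum>k<n. real (A (Suc k) \<omega> $ i)) / n) \<longlonglongrightarrow> rate i) \<and>
      (\<forall>x n i. success E (N x n \<omega>) i \<le> state x n \<omega> $ i) \<and>
      (\<forall>q i. \<forall>\<^sub>F m in sequentially. \<forall>x. (\<Sum>i\<in>UNIV. x $ i) = m \<longrightarrow>
        (\<forall>n\<le>Suc q * m. \<bar>deviation x i n \<omega>\<bar> \<le> m / Suc q))"
    using AE_arrivals_average AE_success_le_state AE_success_average
    by (simp add: AE_all_countable AE_conj_iff del: of_nat_Suc mult_Suc)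
  then show ?thesis
  proof (rule AE_mp, intro AE_I2 impI)
    fix \<omega>
    assume *: "(\<forall>i. (\<lambda>n. (\<Sum>k<n. real (A (Suc k) \<omega> $ i)) / n) \<longlonglongrightarrow> rate i) \<and>
      (\<forall>x n i. success E (N x n \<omega>) i \<le> state x n \<omega> $ i) \<and>
      (\<forall>q i. \<forall>\<^sub>F m in sequentially. \<forall>x. (\<Sum>i\<in>UNIV. x $ i) = m \<longrightarrow>
        (\<forall>n\<le>Suc q * m. \<bar>deviation x i n \<omega>\<bar> \<le> m / Suc q))"
    show "fluid_realisation E rate (\<lambda>n. A n \<omega>) (\<lambda>x n. N x n \<omega>)"
    proof
      fix i and e T :: real
      assume e: "0 < e"
      \<comment> \<open>One integer dominates the horizon and the inverse tolerance;
        \<open>Suc q\<close> keeps it positive.\<close>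
      obtain q :: nat where q: "max T (1 / e) \<le> q" using real_arch_simple by blast
      have qe: "1 / Suc q \<le> e" using q e by (simp add: field_simps add_increasing)
      obtain m0 where m0: "\<And>m x n. m0 \<le> m \<Longrightarrow> (\<Sum>i\<in>UNIV. x $ i) = m \<Longrightarrow> n \<le> Suc q * m \<Longrightarrow>
          \<bar>deviation x i n \<omega>\<bar> \<le> m / Suc q"
        using * unfolding eventually_sequentially by meson
      show "\<forall>\<^sub>F m in at_top. \<forall>x. l1_norm (real_vec x) = m \<longrightarrow> (\<forall>n. real n \<le> T * m \<longrightarrow>
          \<bar>\<Sum>k<n. real (success E (N x k \<omega>) i) - success_prob E (state x k \<omega>) i\<bar> \<le> e * m)"
        using eventually_ge_at_top[of "real m0"]
      proof eventually_elim
        case (elim m)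
        show ?case
        proof (intro allI impI)
          fix x :: "nat ^ 'k" and n :: nat
          assume x: "l1_norm (real_vec x) = m" and n: "real n \<le> T * m"
          \<comment> \<open>Norms of initial states are integers, so the bound along naturals gives
            the one along real \<open>m\<close>.\<close>
          define s where "s = (\<Sum>i\<in>UNIV. x $ i)"
          have m: "m = real s" using x by (simp add: l1_norm_real_vec s_def)
          have "real n \<le> real (Suc q) * real s"
            using n q unfolding m by (intro order_trans[OF n[unfolded m] mult_right_mono]) auto
          then have "n \<le> Suc q * s" by (simp only: of_nat_mult[symmetric] of_nat_le_iff)
          moreover have "m0 \<le> s" using elim m by simp
          ultimately have "\<bar>deviation x i n \<omega>\<bar> \<le> s / Suc q"
            using m0 s_def by metis
          also have "\<dots> \<le> e * m"
            using mult_right_mono[OF qe, of m] m by simp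
          finally show "\<bar>\<Sum>k<n. real (success E (N x k \<omega>) i) - success_prob E (state x k \<omega>) i\<bar> \<le> e * m"
            by (simp add: success_deviation_def)
        qed
      qed
    qed (use * in auto)
  qed
qed

end

theorem lemma8:
  fixes M :: "'w measure"
    and E :: "('k::finite \<times> 'k) set"
    and rate :: "'k \<Rightarrow> real"
    and A :: "nat \<Rightarrow> 'w \<Rightarrow> nat ^ 'k"
    and N :: "nat ^ 'k \<Rightarrow> nat \<Rightarrow> 'w \<Rightarrow> nat ^ 'k"
    and lam :: real and V :: nat
  assumes model: "medium_access M E rate A N"
    and symmetric_rate: "\<And>i. rate i = lam"
    and symmetric_nbhd: "\<And>i. card (closed_nbhd E i) = V"
  shows
    "(AE \<omega> in M. \<forall>z. fluid_limit E (\<lambda>n. A n \<omega>) (\<lambda>x n. N x n \<omega>) z \<longrightarrow>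
        (\<forall>t\<ge>0. (\<forall>i. z t $ i > 0) \<longrightarrow>
          (\<exists>D. ((\<lambda>s. \<Sum>i\<in>UNIV. (z s $ i)\<^sup>2) has_real_derivative D) (at t within {0..}) \<and>
               D \<le> 2 * (lam - exp (- 1) / real V) * (\<Sum>i\<in>UNIV. z t $ i))))
     \<and>
     (lam < exp (- 1) / real V \<longrightarrow>
       (\<exists>\<epsilon>>0. AE \<omega> in M. \<forall>z. fluid_limit E (\<lambda>n. A n \<omega>) (\<lambda>x n. N x n \<omega>) z \<longrightarrow>
        (\<forall>t\<ge>0. (\<forall>i. z t $ i > 0) \<longrightarrow>
          (\<exists>D. ((\<lambda>s. \<Sum>i\<in>UNIV. (z s $ i)\<^sup>2) has_real_derivative D) (at t within {0..}) \<and>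
               D \<le> - \<epsilon> * (\<Sum>i\<in>UNIV. z t $ i)))))"
    (is "?bound \<and> (?stable \<longrightarrow> ?decay)")
proof -
  interpret medium_access M E rate A N by (rule model)
  have bound: ?bound
    using AE_fluid_realisation
  proof (rule AE_mp, intro AE_I2 impI allI)
    fix \<omega> z t
    assume realisation: "fluid_realisation E rate (\<lambda>n. A n \<omega>) (\<lambda>x n. N x n \<omega>)"
      and "fluid_limit E (\<lambda>n. A n \<omega>) (\<lambda>x n. N x n \<omega>) z" "0 \<le> t" "\<forall>i. 0 < z t $ i"
    then show "\<exists>D. ((\<lambda>s. \<Sum>i\<in>UNIV. (z s $ i)\<^sup>2) has_real_derivative D) (at t within {0..}) \<and>
               D \<le> 2 * (lam - exp (- 1) / real V) * (\<Sum>i\<in>UNIV. z t $ i)"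
      by (intro fluid_realisation.fluid_limit_lyapunov_derivative[OF realisation])
        (auto simp: undirected symmetric_rate symmetric_nbhd)
  qed
  moreover have ?decay if ?stable
  proof (intro exI conjI)
    \<comment> \<open>The witness for \<open>\<epsilon>\<close> is minus the factor in the first
      bound, a constant of the model.\<close>
    show "0 < 2 * (exp (- 1) / real V - lam)" using that by simp
    have "2 * (lam - exp (- 1) / real V) = - (2 * (exp (- 1) / real V - lam))" by simp
    then show "AE \<omega> in M. \<forall>z. fluid_limit E (\<lambda>n. A n \<omega>) (\<lambda>x n. N x n \<omega>) z \<longrightarrow>
        (\<forall>t\<ge>0. (\<forall>i. z t $ i > 0) \<longrightarrow>
          (\<exists>D. ((\<lambda>s. \<Sum>i\<in>UNIV. (z s $ i)\<^sup>2) has_real_derivative D) (at t within {0..}) \<and>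
               D \<le> - (2 * (exp (- 1) / real V - lam)) * (\<Sum>i\<in>UNIV. z t $ i)))"
      using bound by simp
  qed
  ultimately show ?thesis by blast
qed

end
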